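(* Let $L\ge 1$ be an integer, $\delta>0$, and let $G_+,G_->0$ be real numbers satisfying $G_+-G_-=2\delta$ or $G_+-G_-=-2\delta$. Let $$H=\sum_{j=1}^{L}\epsilon_j n_j-\sum_{j,k=1}^{L}G_{jk}\,c_{k+}^{\dagger}c_{k-}^{\dagger}c_{j-}c_{j+},\qquad \epsilon_j=\Big(j-\frac{L+1}{2}\Big)\delta,$$ with $G_{jk}=G_+$ for $j<k$, $G_{jk}=\tfrac12(G_++G_-)$ for $j=k$, and $G_{jk}=G_-$ for $j>k$. Then the spectrum of $H$ is real, i.e. every eigenvalue of $H$ is a real number.
   Context: The operators $c_{j\pm},c_{j\pm}^\dagger$ ($j=1,\dots,L$) are fermionic annihilation and creation operators satisfying the canonical anticommutation relations $\{c_{j\sigma},c_{k\tau}^\dagger\}=\delta_{jk}\delta_{\sigma\tau}$ (Kronecker deltas), $\{c_{j\sigma},c_{k\tau}\}=0$, acting on the $4^L$-dimensional complex fermionic Fock space; $n_j=c_{j+}^\dagger c_{j+}+c_{j-}^\dagger c_{j-}$. The parameter $\delta>0$ is the level spacing. The operator $H$ is in general not hermitian. *)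

theory Defs
  imports Complex_Main
begin

section \<open>Fermionic Fock space in the occupation number representation\<close>

datatype spin = Plus | Minus

type_synonym mode = "nat \<times> spin"

text \<open>
  A Fock space vector is the family of its amplitudes in the occupation number basis; the
  basis vectors are labelled by the set of occupied modes.
\<close>

type_synonym fock = "mode set \<Rightarrow> complex"

definition modes :: "nat \<Rightarrow> mode set" where
  "modes L = {1..L} \<times> {Plus, Minus}"

definition Fock :: "nat \<Rightarrow> fock set" where
  "Fock L = {\<psi>. \<forall>S. \<not> S \<subseteq> modes L \<longrightarrow> \<psi> S = 0}"

text \<open>
  The basis vector labelled by \<open>S\<close> is the product of the creation operators of the modes in
  \<open>S\<close>, in increasing order from left to right, applied to the vacuum. The order is
  \<open>(1,Plus)\<close>, \<open>(1,Minus)\<close>, \<open>(2,Plus)\<close>, \<open>(2,Minus)\<close>, ...; it fixes the Jordan--Wigner signs.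
\<close>

definition precedes :: "mode \<Rightarrow> mode \<Rightarrow> bool" where
  "precedes m n \<longleftrightarrow> fst m < fst n \<or> (fst m = fst n \<and> snd m = Plus \<and> snd n = Minus)"

definition jw_sign :: "mode \<Rightarrow> mode set \<Rightarrow> complex" where
  "jw_sign m S = (- 1) ^ card {n \<in> S. precedes n m}"

definition annih :: "mode \<Rightarrow> fock \<Rightarrow> fock" where
  "annih m \<psi> = (\<lambda>S. if m \<in> S then 0 else jw_sign m S * \<psi> (insert m S))"

definition create :: "mode \<Rightarrow> fock \<Rightarrow> fock" where
  "create m \<psi> = (\<lambda>S. if m \<in> S then jw_sign m S * \<psi> (S - {m}) else 0)"

definition number :: "nat \<Rightarrow> fock \<Rightarrow> fock" where
  "number j \<psi> = (\<lambda>S. create (j, Plus) (annih (j, Plus) \<psi>) S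
                     + create (j, Minus) (annih (j, Minus) \<psi>) S)"

definition fock_inner :: "nat \<Rightarrow> fock \<Rightarrow> fock \<Rightarrow> complex" where
  "fock_inner L \<phi> \<psi> = (\<Sum>S\<in>Pow (modes L). cnj (\<phi> S) * \<psi> S)"


section \<open>The Hamiltonian and its eigenvalues\<close>

definition level :: "nat \<Rightarrow> real \<Rightarrow> nat \<Rightarrow> real" where
  "level L \<delta> j = (real j - (real L + 1) / 2) * \<delta>"

definition coupling :: "real \<Rightarrow> real \<Rightarrow> nat \<Rightarrow> nat \<Rightarrow> real" where
  "coupling Gp Gm j k = (if j < k then Gp else if j = k then (Gp + Gm) / 2 else Gm)"

definition hamiltonian :: "nat \<Rightarrow> real \<Rightarrow> real \<Rightarrow> real \<Rightarrow> fock \<Rightarrow> fock" where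
  "hamiltonian L \<delta> Gp Gm \<psi> = (\<lambda>S.
     (\<Sum>j=1..L. of_real (level L \<delta> j) * number j \<psi> S)
     - (\<Sum>j=1..L. \<Sum>k=1..L. of_real (coupling Gp Gm j k) *
          create (k, Plus) (create (k, Minus) (annih (j, Minus) (annih (j, Plus) \<psi>))) S))"

definition eigenvalues_on :: "fock set \<Rightarrow> (fock \<Rightarrow> fock) \<Rightarrow> complex set" where
  "eigenvalues_on V A = {E. \<exists>\<psi>\<in>V. \<psi> \<noteq> (\<lambda>S. 0) \<and> A \<psi> = (\<lambda>S. E * \<psi> S)}"


section \<open>Anticommutation relations, adjointness and dimension\<close>

lemma finite_modes [simp]: "finite (modes L)"
  by (simp add: modes_def)

lemma card_basis: "card (Pow (modes L)) = 4 ^ L"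
proof -
  have "card (modes L) = 2 * L"
    by (simp add: modes_def card_cartesian_product)
  then show ?thesis
    by (simp add: card_Pow power_mult)
qed

lemma annih_in_Fock: "\<psi> \<in> Fock L \<Longrightarrow> annih m \<psi> \<in> Fock L"
  by (auto simp: Fock_def annih_def)

lemma create_in_Fock:
  assumes "\<psi> \<in> Fock L" "m \<in> modes L"
  shows "create m \<psi> \<in> Fock L"
proof -
  have "\<not> S - {m} \<subseteq> modes L" if "\<not> S \<subseteq> modes L" for S
    using that assms(2) by auto
  with assms(1) show ?thesis
    by (simp add: Fock_def create_def)
qed

lemma number_in_Fock: "\<psi> \<in> Fock L \<Longrightarrow> j \<in> {1..L} \<Longrightarrow> number j \<psi> \<in> Fock L"
  using create_in_Fock[OF annih_in_Fock, of \<psi> L]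
  by (auto simp: number_def Fock_def modes_def)

lemma hamiltonian_in_Fock: "\<psi> \<in> Fock L \<Longrightarrow> hamiltonian L \<delta> Gp Gm \<psi> \<in> Fock L"
proof -
  assume \<psi>: "\<psi> \<in> Fock L"
  have "create (k, Plus) (create (k, Minus) (annih (j, Minus) (annih (j, Plus) \<psi>))) \<in> Fock L"
    if "k \<in> {1..L}" for j k
    using that \<psi> by (intro create_in_Fock annih_in_Fock) (auto simp: modes_def)
  with number_in_Fock[OF \<psi>] show ?thesis
    by (simp add: Fock_def hamiltonian_def)
qed

lemma precedes_irrefl [simp]: "\<not> precedes m m"
  by (auto simp: precedes_def)

lemma precedes_total: "m \<noteq> n \<Longrightarrow> precedes m n \<longleftrightarrow> \<not> precedes n m"
  by (cases m; cases n; cases "snd m"; cases "snd n") (auto simp: precedes_def)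

lemma jw_sign_insert:
  assumes "finite S" "n \<notin> S"
  shows "jw_sign m (insert n S) = (if precedes n m then - 1 else 1) * jw_sign m S"
proof -
  have "{x \<in> insert n S. precedes x m} =
        (if precedes n m then insert n {x \<in> S. precedes x m} else {x \<in> S. precedes x m})"
    by auto
  then show ?thesis
    using assms by (simp add: jw_sign_def)
qed

lemma jw_sign_remove: "jw_sign m (S - {m}) = jw_sign m S"
proof -
  have "{n \<in> S - {m}. precedes n m} = {n \<in> S. precedes n m}"
    by auto
  then show ?thesis
    by (simp add: jw_sign_def)
qed

lemma jw_sign_insert_same [simp]: "jw_sign m (insert m S) = jw_sign m S"
  using jw_sign_remove[of m "insert m S"] jw_sign_remove[of m S] by simp

lemma jw_sign_square [simp]: "jw_sign m S * jw_sign m S = 1"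
  by (simp add: jw_sign_def flip: power_add mult_2)

lemma cnj_jw_sign [simp]: "cnj (jw_sign m S) = jw_sign m S"
  by (simp add: jw_sign_def)

lemma car_annih_annih:
  assumes "finite S"
  shows "annih m (annih n \<psi>) S + annih n (annih m \<psi>) S = 0"
proof (cases "m = n \<or> m \<in> S \<or> n \<in> S")
  case True
  then show ?thesis by (auto simp: annih_def)
next
  case False
  then show ?thesis
    using assms precedes_total[of m n]
    by (auto simp: annih_def jw_sign_insert insert_commute)
qed

lemma car_annih_create:
  assumes "finite S"
  shows "annih m (create n \<psi>) S + create n (annih m \<psi>) S = (if m = n then \<psi> S else 0)"
proof (cases "m = n")
  case True
  then show ?thesis
    by (auto simp: annih_def create_def jw_sign_remove insert_absorb simp flip: mult.assoc)
next
  case False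
  show ?thesis
  proof (cases "m \<notin> S \<and> n \<in> S")
    case True
    define T where "T = S - {n}"
    have S: "S = insert n T" and T: "n \<notin> T" "m \<notin> T" "finite T"
      using True assms by (auto simp: T_def)
    have "insert m (insert n T) - {n} = insert m T"
      using T False by auto
    then show ?thesis
      using False S T precedes_total[of m n]
      by (auto simp: annih_def create_def jw_sign_insert)
  qed (use False in \<open>auto simp: annih_def create_def\<close>)
qed

lemma create_adjoint_annih:
  assumes "m \<in> modes L"
  shows "fock_inner L (create m \<phi>) \<psi> = fock_inner L \<phi> (annih m \<psi>)"
proof -
  let ?P = "Pow (modes L)"
  have "fock_inner L (create m \<phi>) \<psi>
        = (\<Sum>S\<in>{S\<in>?P. m \<in> S}. cnj (jw_sign m S * \<phi> (S - {m})) * \<psi> S)"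
    unfolding fock_inner_def by (rule sum.mono_neutral_cong_right) (auto simp: create_def)
  also have "\<dots> = (\<Sum>S\<in>{S\<in>?P. m \<notin> S}. cnj (\<phi> S) * (jw_sign m S * \<psi> (insert m S)))"
    by (rule sum.reindex_bij_witness[where i = "insert m" and j = "\<lambda>S. S - {m}"])
       (use assms in \<open>auto simp: insert_absorb jw_sign_remove cnj_jw_sign\<close>)
  also have "\<dots> = fock_inner L \<phi> (annih m \<psi>)"
    unfolding fock_inner_def by (rule sum.mono_neutral_cong_left) (auto simp: annih_def)
  finally show ?thesis .
qed

end

theory Submission
  imports Defs "HOL-Combinatorics.Transposition"
    "HOL-Analysis.L2_Norm" "Jordan_Normal_Form.Char_Poly"
begin

text \<open>
  Singly occupied levels are inert, so \<open>H\<close> splits into pair Hamiltonians \<open>H(l)\<close> on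
  \<open>(\<complex>\<^sup>2)\<close>-chains, one for each list \<open>l\<close> of unblocked levels; here the order of the list decides which
  hops carry \<open>G\<^sub>+\<close> and which \<open>G\<^sub>-\<close>. With \<open>h = (G\<^sub>+ - G\<^sub>-) / 2\<close> the operator
  \<open>R\<^sub>a\<^sub>b = (\<epsilon>\<^sub>b - \<epsilon>\<^sub>a) - h P\<^sub>a\<^sub>b\<close>, where \<open>P\<^sub>a\<^sub>b\<close> exchanges the sites \<open>a\<close> and \<open>b\<close>, intertwines the
  Hamiltonians of two orders that differ by an adjacent exchange of \<open>a\<close> and \<open>b\<close>. Reversing the
  whole list gives a product \<open>W\<close> of such factors with \<open>W H(l) = H(rev l) W\<close>, and \<open>H(rev l)\<close> is the
  adjoint of \<open>H(l)\<close>. By the Yang--Baxter equation \<open>W\<close> is self-adjoint. If consecutive levels are more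
  than \<open>\<bar>h\<bar>\<close> apart, all factors stay invertible when \<open>h\<close> is scaled down to \<open>0\<close>, where \<open>W\<close> is a positive
  scalar; so \<open>W\<close> is positive definite and \<open>H(l)\<close> is self-adjoint for the inner product it defines.

  At the spacing \<open>\<delta> = \<bar>h\<bar>\<close> the form \<open>W\<close> degenerates. There one stretches the levels by \<open>1 + t\<close> and lets
  \<open>t\<close> tend to \<open>0\<close>: a monic polynomial \<open>p\<close> of degree \<open>n\<close> with only real roots satisfies
  \<open>\<bar>p(E)\<bar> \<ge> \<bar>Im E\<bar>\<^sup>n\<close>, and this bound survives the limit.
\<close>

type_synonym 'a state = "'a set \<Rightarrow> complex"
type_synonym 'a oper = "'a state \<Rightarrow> 'a state"

section \<open>Moving through the orderings of a list\<close>

text \<open>\<open>move\<close> and \<open>reversal\<close> spell out one reduced word of the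
  order-reversing permutation: the head passes through the whole tail, then the tail is
  reversed.\<close>

primrec move :: "('a \<Rightarrow> 'a \<Rightarrow> 'b \<Rightarrow> 'b) \<Rightarrow> 'a \<Rightarrow> 'a list \<Rightarrow> 'b \<Rightarrow> 'b" where
  "move R x [] \<phi> = \<phi>"
| "move R x (y # l) \<phi> = move R x l (R x y \<phi>)"

primrec reversal :: "('a \<Rightarrow> 'a \<Rightarrow> 'b \<Rightarrow> 'b) \<Rightarrow> 'a list \<Rightarrow> 'b \<Rightarrow> 'b" where
  "reversal R [] \<phi> = \<phi>"
| "reversal R (x # l) \<phi> = reversal R l (move R x l \<phi>)"

text \<open>\<open>A\<close> is a family of operators indexed by orderings, and \<open>R a b\<close>
  intertwines neighbouring orderings. The set \<open>F\<close> of excluded labels allows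
  \<open>move R x\<close> to be such a family itself, for lists that avoid \<open>x\<close>.\<close>

definition exchanges :: "('a \<Rightarrow> 'a \<Rightarrow> 'b \<Rightarrow> 'b) \<Rightarrow> ('a list \<Rightarrow> 'b \<Rightarrow> 'b) \<Rightarrow> 'a set \<Rightarrow> bool" where
  "exchanges R A F \<longleftrightarrow> (\<forall>p a b s \<phi>. distinct (p @ a # b # s) \<longrightarrow> F \<inter> set (p @ a # b # s) = {} \<longrightarrow>
     R a b (A (p @ a # b # s) \<phi>) = A (p @ b # a # s) (R a b \<phi>))"

lemma exchangesD:
  "exchanges R A F \<Longrightarrow> distinct (p @ a # b # s) \<Longrightarrow> F \<inter> set (p @ a # b # s) = {} \<Longrightarrow>
     R a b (A (p @ a # b # s) \<phi>) = A (p @ b # a # s) (R a b \<phi>)"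
  unfolding exchanges_def by blast

text \<open>Each factor of \<open>move\<close> is one adjacent exchange. The labels already passed
  join the prefix, so \<open>p\<close> has to vary in the induction.\<close>

lemma move_exchange:
  assumes "exchanges R A F" "distinct (p @ x # l @ s)" "F \<inter> set (p @ x # l @ s) = {}"
  shows "move R x l (A (p @ x # l @ s) \<phi>) = A (p @ l @ x # s) (move R x l \<phi>)"
  using assms(2,3)
proof (induction l arbitrary: p \<phi>)
  case (Cons y l)
  have "R x y (A (p @ x # y # l @ s) \<phi>) = A (p @ y # x # l @ s) (R x y \<phi>)"
    using Cons.prems by (intro exchangesD[OF assms(1)]) auto
  moreover have "move R x l (A ((p @ [y]) @ x # l @ s) (R x y \<phi>)) =
      A ((p @ [y]) @ l @ x # s) (move R x l (R x y \<phi>))"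
    using Cons.prems by (intro Cons.IH) auto
  ultimately show ?case
    by simp
qed simp

text \<open>After its move \<open>x\<close> stands behind \<open>l\<close> and joins the suffix
  \<open>s\<close>, which the later exchanges leave in place.\<close>

lemma reversal_exchange:
  assumes "exchanges R A F" "distinct (l @ s)" "F \<inter> set (l @ s) = {}"
  shows "reversal R l (A (l @ s) \<phi>) = A (rev l @ s) (reversal R l \<phi>)"
  using assms(2,3)
proof (induction l arbitrary: s \<phi>)
  case (Cons x l)
  have "move R x l (A ([] @ x # l @ s) \<phi>) = A ([] @ l @ x # s) (move R x l \<phi>)"
    using Cons.prems by (intro move_exchange[OF assms(1)]) auto
  moreover have "reversal R l (A (l @ x # s) \<psi>) = A (rev l @ x # s) (reversal R l \<psi>)" for \<psi>
    using Cons.prems by (intro Cons.IH) auto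
  ultimately show ?case
    by simp
qed simp

lemma move_append: "move R x (l @ k) \<phi> = move R x k (move R x l \<phi>)"
  by (induction l arbitrary: \<phi>) auto

section \<open>The rational R-matrix\<close>

text \<open>Yang's rational R-matrix with spectral parameter \<open>e b - e a\<close>. Exchanging
  two sites acts on a configuration by taking the image of its set of occupied sites.\<close>

definition rmat :: "('a \<Rightarrow> real) \<Rightarrow> real \<Rightarrow> 'a \<Rightarrow> 'a \<Rightarrow> 'a oper" where
  "rmat e h a b \<phi> = (\<lambda>X. of_real (e b - e a) * \<phi> X - of_real h * \<phi> (transpose a b ` X))"

lemma rmat_commute:
  assumes "x \<notin> {a, b}" "y \<notin> {a, b}"
  shows "rmat e h a b (rmat e h x y \<phi>) = rmat e h x y (rmat e h a b \<phi>)"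
proof -
  have "transpose x y \<circ> transpose a b = transpose a b \<circ> transpose x y"
    using assms by (auto simp: fun_eq_iff transpose_def)
  then have "transpose x y ` transpose a b ` X = transpose a b ` transpose x y ` X" for X
    by (metis image_comp)
  then show ?thesis
    by (simp add: rmat_def fun_eq_iff algebra_simps)
qed

text \<open>Expand in powers of \<open>h\<close>: the cubic terms agree by the braid relation, and
  the quadratic ones, multiples of the two 3-cycles, agree because level differences add up,
  \<open>e b - e x = (e b - e a) + (e a - e x)\<close>.\<close>

lemma yang_baxter:
  assumes "a \<noteq> b" "a \<noteq> x" "b \<noteq> x"
  shows "rmat e h a b (rmat e h x b (rmat e h x a \<phi>)) = rmat e h x a (rmat e h x b (rmat e h a b \<phi>))"
proof
  fix X
  have "transpose x a \<circ> transpose x b = transpose a b \<circ> transpose x a"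
       "transpose x b \<circ> transpose a b = transpose a b \<circ> transpose x a"
       "transpose x b \<circ> transpose x a = transpose x a \<circ> transpose a b"
       "transpose a b \<circ> transpose x b = transpose x a \<circ> transpose a b"
       "transpose x a \<circ> (transpose a b \<circ> transpose x a) = transpose a b \<circ> (transpose x a \<circ> transpose a b)"
    using assms by (auto simp: fun_eq_iff transpose_def)
  \<comment> \<open>Oriented as rewrite rules, these bring the products that occur to a normal form
    in \<open>transpose x a\<close> and \<open>transpose a b\<close>.\<close>
  then have *: "transpose x a ` transpose x b ` Y = transpose a b ` transpose x a ` Y"
       "transpose x b ` transpose a b ` Y = transpose a b ` transpose x a ` Y"
       "transpose x b ` transpose x a ` Y = transpose x a ` transpose a b ` Y"
       "transpose a b ` transpose x b ` Y = transpose x a ` transpose a b ` Y"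
       "transpose x a ` transpose a b ` transpose x a ` Y = transpose a b ` transpose x a ` transpose a b ` Y" for Y
    by (metis image_comp)+
  have [simp]: "transpose a b ` transpose a b ` Y = Y" "transpose x a ` transpose x a ` Y = Y" for Y
    by (simp_all add: image_comp)
  show "rmat e h a b (rmat e h x b (rmat e h x a \<phi>)) X = rmat e h x a (rmat e h x b (rmat e h a b \<phi>)) X"
    by (simp add: rmat_def *) (simp add: algebra_simps)
qed

lemma move_rmat_commute:
  assumes "x \<notin> {a, b}" "set l \<inter> {a, b} = {}"
  shows "rmat e h a b (move (rmat e h) x l \<phi>) = move (rmat e h) x l (rmat e h a b \<phi>)"
  using assms(2) by (induction l arbitrary: \<phi>) (use assms(1) in \<open>auto simp: rmat_commute\<close>)

text \<open>The factors \<open>rmat e h x y\<close> with \<open>y\<close> in \<open>p\<close> or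
  \<open>s\<close> commute with \<open>rmat e h a b\<close>, and the three remaining ones are turned
  around by the Yang--Baxter equation. Thus \<open>reversal_exchange\<close> applies to the moves
  themselves.\<close>

lemma exchanges_move: "exchanges (rmat e h) (move (rmat e h) x) {x}"
  unfolding exchanges_def
proof (intro allI impI)
  fix p a b s \<phi>
  assume d: "distinct (p @ a # b # s)" "{x} \<inter> set (p @ a # b # s) = {}"
  let ?m = "move (rmat e h) x" and ?R = "rmat e h"
  have "?R a b (?m (p @ a # b # s) \<phi>) = ?m s (?R a b (?R x b (?R x a (?m p \<phi>))))"
    using d by (simp add: move_append) (subst move_rmat_commute; auto)
  also have "\<dots> = ?m s (?R x a (?R x b (?R a b (?m p \<phi>))))"
    using d by (subst yang_baxter) auto
  also have "\<dots> = ?m (p @ b # a # s) (?R a b \<phi>)"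
    using d by (simp add: move_append) (subst move_rmat_commute; auto)
  finally show "?R a b (?m (p @ a # b # s) \<phi>) = ?m (p @ b # a # s) (?R a b \<phi>)" .
qed

section \<open>The pair Hamiltonian\<close>

text \<open>Transfers a pair from \<open>j\<close> to \<open>k\<close>; the amplitude at
  \<open>X\<close> is read off at the configuration before the transfer. For \<open>j = k\<close> it
  vanishes, so the diagonal coupling goes into the energy instead.\<close>

definition hop :: "'a \<Rightarrow> 'a \<Rightarrow> 'a oper" where
  "hop j k \<phi> X = (if k \<in> X \<and> j \<notin> X then \<phi> (insert j (X - {k})) else 0)"

primrec hops :: "real \<Rightarrow> real \<Rightarrow> 'a list \<Rightarrow> 'a oper" where
  "hops Gp Gm [] \<phi> X = 0"
| "hops Gp Gm (x # l) \<phi> X =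
     (\<Sum>k\<leftarrow>l. of_real Gp * hop x k \<phi> X + of_real Gm * hop k x \<phi> X) + hops Gp Gm l \<phi> X"

definition pair_energy :: "('a \<Rightarrow> real) \<Rightarrow> 'a list \<Rightarrow> 'a set \<Rightarrow> real" where
  "pair_energy v l X = (\<Sum>j\<leftarrow>l. if j \<in> X then v j else 0)"

text \<open>A pair on level \<open>j\<close> costs \<open>2 * e j\<close> and gains the diagonal
  coupling \<open>(Gp + Gm) / 2\<close>.\<close>

definition pair_ham :: "('a \<Rightarrow> real) \<Rightarrow> real \<Rightarrow> real \<Rightarrow> 'a list \<Rightarrow> 'a oper" where
  "pair_ham e Gp Gm l \<phi> X =
     of_real (pair_energy (\<lambda>j. 2 * e j - (Gp + Gm) / 2) l X) * \<phi> X - hops Gp Gm l \<phi> X"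

section \<open>Hops under relabelling and reordering of the sites\<close>

lemma hop_transpose:
  "hop j k \<phi> (transpose a b ` X) =
   hop (transpose a b j) (transpose a b k) (\<lambda>Y. \<phi> (transpose a b ` Y)) X"
proof -
  have "insert j (transpose a b ` X - {k}) =
     transpose a b ` insert (transpose a b j) (X - {transpose a b k})"
    by (rule Set.set_eqI) (simp add: in_transpose_image_iff inj_eq[OF inj_transpose] del: image_insert)
  then show ?thesis
    by (simp add: hop_def in_transpose_image_iff)
qed

lemma hops_transpose:
  "hops Gp Gm l \<phi> (transpose a b ` X) =
   hops Gp Gm (map (transpose a b) l) (\<lambda>Y. \<phi> (transpose a b ` Y)) X"
  by (induction l) (auto simp: hop_transpose o_def)

lemma hops_linear:
  fixes l :: "'a list"
  shows
  "hops Gp Gm l (\<lambda>Y. c * \<phi> Y - d * \<psi> Y) X = c * hops Gp Gm l \<phi> X - d * hops Gp Gm l \<psi> X"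
proof -
  have *: "hop j k (\<lambda>Y. c * \<phi> Y - d * \<psi> Y) X = c * hop j k \<phi> X - d * hop j k \<psi> X" for j k
    by (simp add: hop_def)
  have "(\<Sum>k\<leftarrow>l. of_real Gp * hop x k (\<lambda>Y. c * \<phi> Y - d * \<psi> Y) X + of_real Gm * hop k x (\<lambda>Y. c * \<phi> Y - d * \<psi> Y) X)
      = c * (\<Sum>k\<leftarrow>l. of_real Gp * hop x k \<phi> X + of_real Gm * hop k x \<phi> X)
        - d * (\<Sum>k\<leftarrow>l. of_real Gp * hop x k \<psi> X + of_real Gm * hop k x \<psi> X)" for x and l :: "'a list"
    unfolding * by (induction l) (simp_all add: algebra_simps)
  then show ?thesis
    by (induction l) (simp_all add: algebra_simps)
qed

text \<open>Seen from the end of the list the two couplings trade places; this matches the adjoint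
  with the reversed list.\<close>

lemma hops_append_snoc:
  "hops Gp Gm (l @ [x]) \<phi> X =
   hops Gp Gm l \<phi> X + (\<Sum>k\<leftarrow>l. of_real Gp * hop k x \<phi> X + of_real Gm * hop x k \<phi> X)"
  by (induction l) (simp_all add: algebra_simps)

text \<open>Every other pair of sites keeps its relative order, so its hops cancel.\<close>

lemma hops_exchange:
  "hops Gp Gm (p @ a # b # s) \<phi> X - hops Gp Gm (p @ b # a # s) \<phi> X =
   of_real (Gp - Gm) * (hop a b \<phi> X - hop b a \<phi> X)"
  by (induction p) (simp_all add: algebra_simps)

text \<open>Two defects cancel. Reordering changes only the hops between \<open>a\<close> and
  \<open>b\<close>, and the difference of these two hops is the site exchange times a difference of
  occupations. Exchanging the sites turns the hops of one order into those of the other, but shifts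
  the diagonal by \<open>2 * (e b - e a)\<close> times the same difference, up to sign.\<close>

lemma exchanges_pair_ham:
  fixes e :: "'a \<Rightarrow> real"
  assumes "Gp - Gm = 2 * h"
  shows "exchanges (rmat e h) (pair_ham e Gp Gm) {}"
  unfolding exchanges_def
proof (intro allI impI ext)
  fix p s :: "'a list" and a b and \<phi> :: "'a state" and X
  assume d: "distinct (p @ a # b # s)"
  let ?l = "p @ a # b # s" and ?l' = "p @ b # a # s" and ?t = "transpose a b"
  define v where "v = (\<lambda>j. 2 * e j - (Gp + Gm) / 2)"
  define \<phi>' where "\<phi>' = (\<lambda>Y. \<phi> (?t ` Y))"
  define E where "E = pair_energy v ?l"
  have tfix: "map ?t p = p" "map ?t s = s"
    using d by (auto intro!: map_idI simp: transpose_def)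
  have e1: "pair_energy v ?l' X = E X"
    by (simp add: E_def pair_energy_def)
  have "(\<Sum>j\<leftarrow>q. if j \<in> ?t ` X then v j else 0) = (\<Sum>j\<leftarrow>q. if j \<in> X then v j else 0)"
    if "map ?t q = q" for q
    using that by (induction q) (auto simp: in_transpose_image_iff)
  then have ps: "(\<Sum>j\<leftarrow>q. if j \<in> ?t ` X then v j else 0) = (\<Sum>j\<leftarrow>q. if j \<in> X then v j else 0)"
    if "q \<in> {p, s}" for q
    using that tfix by blast
  have ab: "a \<in> ?t ` X \<longleftrightarrow> b \<in> X" "b \<in> ?t ` X \<longleftrightarrow> a \<in> X"
    by (simp_all add: in_transpose_image_iff)
  have "v b - v a = 2 * (e b - e a)"
    by (simp add: v_def)
  then have e2: "E (?t ` X) - E X = 2 * (e b - e a) * ((if a \<in> X then 1 else 0) - (if b \<in> X then 1 else 0))"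
    by (simp add: E_def pair_energy_def ps ab)
  have k1: "hops Gp Gm ?l \<phi> (?t ` X) = hops Gp Gm ?l' \<phi>' X"
    using tfix by (simp add: hops_transpose \<phi>'_def)
  have k2: "hops Gp Gm ?l' \<phi> X = hops Gp Gm ?l \<phi> X - of_real (2 * h) * (hop a b \<phi> X - hop b a \<phi> X)"
    using hops_exchange[of Gp Gm p a b s \<phi> X] assms by (simp add: algebra_simps)
  \<comment> \<open>If the two sites are both empty or both occupied, both sides vanish; otherwise
    the single allowed hop exchanges them.\<close>
  have k3: "hop a b \<phi> X - hop b a \<phi> X = ((if b \<in> X then 1 else 0) - (if a \<in> X then 1 else 0)) * \<phi>' X"
  proof -
    have "?t ` X = insert a (X - {b})" if "b \<in> X" "a \<notin> X"
      using that by (auto simp: transpose_def image_iff)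
    moreover have "?t ` X = insert b (X - {a})" if "a \<in> X" "b \<notin> X"
      using that by (auto simp: transpose_def image_iff)
    ultimately show ?thesis
      by (simp add: hop_def \<phi>'_def)
  qed
  have lin: "hops Gp Gm ?l' (rmat e h a b \<phi>) X = of_real (e b - e a) * hops Gp Gm ?l' \<phi> X - of_real h * hops Gp Gm ?l' \<phi>' X"
    unfolding rmat_def \<phi>'_def by (rule hops_linear)
  have E2: "E (?t ` X) = E X + 2 * (e b - e a) * ((if a \<in> X then 1 else 0) - (if b \<in> X then 1 else 0))"
    using e2 by simp
  have "rmat e h a b (pair_ham e Gp Gm ?l \<phi>) X =
     of_real (e b - e a) * (of_real (E X) * \<phi> X - hops Gp Gm ?l \<phi> X)
     - of_real h * (of_real (E (?t ` X)) * \<phi>' X - hops Gp Gm ?l' \<phi>' X)"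
    unfolding rmat_def pair_ham_def k1 by (simp add: E_def v_def \<phi>'_def)
  also have "\<dots> = of_real (E X) * (of_real (e b - e a) * \<phi> X - of_real h * \<phi>' X)
     - (of_real (e b - e a) * hops Gp Gm ?l' \<phi> X - of_real h * hops Gp Gm ?l' \<phi>' X)"
    unfolding k2 k3 E2 by (auto simp: algebra_simps)
  also have "\<dots> = pair_ham e Gp Gm ?l' (rmat e h a b \<phi>) X"
    unfolding pair_ham_def lin using e1 by (simp add: v_def rmat_def \<phi>'_def)
  finally show "rmat e h a b (pair_ham e Gp Gm ?l \<phi>) X = pair_ham e Gp Gm ?l' (rmat e h a b \<phi>) X" .
qed

section \<open>Inner product and adjoints\<close>

text \<open>Only configurations inside \<open>U\<close> count, so on all states the form is merely
  semidefinite: a state of norm zero may be nonzero outside \<open>Pow U\<close>.\<close>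

definition inner_on :: "'a set \<Rightarrow> 'a state \<Rightarrow> 'a state \<Rightarrow> complex" where
  "inner_on U \<phi> \<psi> = (\<Sum>X\<in>Pow U. cnj (\<phi> X) * \<psi> X)"

definition norm_on :: "'a set \<Rightarrow> 'a state \<Rightarrow> real" where
  "norm_on U \<phi> = L2_set (\<lambda>X. cmod (\<phi> X)) (Pow U)"

lemma inner_on_diff_right:
  "inner_on U \<phi> (\<lambda>X. \<psi> X - \<chi> X) = inner_on U \<phi> \<psi> - inner_on U \<phi> \<chi>"
  by (simp add: inner_on_def algebra_simps sum_subtractf)

lemma inner_on_diff_left:
  "inner_on U (\<lambda>X. \<phi> X - \<chi> X) \<psi> = inner_on U \<phi> \<psi> - inner_on U \<chi> \<psi>"
  by (simp add: inner_on_def algebra_simps sum_subtractf)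

lemma inner_on_add_right:
  "inner_on U \<phi> (\<lambda>X. \<psi> X + \<chi> X) = inner_on U \<phi> \<psi> + inner_on U \<phi> \<chi>"
  by (simp add: inner_on_def algebra_simps sum.distrib)

lemma inner_on_add_left:
  "inner_on U (\<lambda>X. \<phi> X + \<chi> X) \<psi> = inner_on U \<phi> \<psi> + inner_on U \<chi> \<psi>"
  by (simp add: inner_on_def algebra_simps sum.distrib)

lemma inner_on_scale_right: "inner_on U \<phi> (\<lambda>X. c * \<psi> X) = c * inner_on U \<phi> \<psi>"
  by (simp add: inner_on_def algebra_simps sum_distrib_left)

lemma inner_on_scale_left: "inner_on U (\<lambda>X. c * \<phi> X) \<psi> = cnj c * inner_on U \<phi> \<psi>"
  by (simp add: inner_on_def algebra_simps sum_distrib_left)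

lemma inner_on_zero [simp]: "inner_on U (\<lambda>X. 0) \<psi> = 0" "inner_on U \<phi> (\<lambda>X. 0) = 0"
  by (simp_all add: inner_on_def)

lemmas inner_on_linear = inner_on_diff_right inner_on_diff_left inner_on_add_right inner_on_add_left
  inner_on_scale_right inner_on_scale_left

lemma inner_on_self: "inner_on U \<phi> \<phi> = of_real ((norm_on U \<phi>)\<^sup>2)"
proof -
  have "cnj z * z = of_real ((cmod z)\<^sup>2)" for z
    by (metis complex_norm_square mult.commute of_real_power)
  then show ?thesis
    unfolding inner_on_def norm_on_def L2_set_def by (simp add: sum_nonneg)
qed

lemma norm_on_nonneg [simp]: "0 \<le> norm_on U \<phi>"
  by (simp add: norm_on_def)

lemma cauchy_schwarz_on: "cmod (inner_on U \<phi> \<psi>) \<le> norm_on U \<phi> * norm_on U \<psi>"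
proof -
  have "cmod (inner_on U \<phi> \<psi>) \<le> (\<Sum>X\<in>Pow U. \<bar>cmod (\<phi> X)\<bar> * \<bar>cmod (\<psi> X)\<bar>)"
    unfolding inner_on_def by (rule sum_norm_le) (simp add: norm_mult)
  also have "\<dots> \<le> norm_on U \<phi> * norm_on U \<psi>"
    unfolding norm_on_def by (rule L2_set_mult_ineq)
  finally show ?thesis .
qed

lemma norm_on_triangle: "norm_on U (\<lambda>X. \<phi> X + \<psi> X) \<le> norm_on U \<phi> + norm_on U \<psi>"
proof -
  have "norm_on U (\<lambda>X. \<phi> X + \<psi> X) \<le> L2_set (\<lambda>X. cmod (\<phi> X) + cmod (\<psi> X)) (Pow U)"
    unfolding norm_on_def by (rule L2_set_mono) (auto simp: norm_triangle_ineq)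
  also have "\<dots> \<le> norm_on U \<phi> + norm_on U \<psi>"
    unfolding norm_on_def by (rule L2_set_triangle_ineq)
  finally show ?thesis .
qed

lemma norm_on_scale: "norm_on U (\<lambda>X. c * \<phi> X) = cmod c * norm_on U \<phi>"
  unfolding norm_on_def by (simp add: norm_mult L2_set_right_distrib)

lemma norm_on_transpose:
  assumes "a \<in> U" "b \<in> U"
  shows "norm_on U (\<lambda>X. \<phi> (transpose a b ` X)) = norm_on U \<phi>"
proof -
  have "transpose a b x \<in> U" if "x \<in> U" for x
    using assms that by (auto simp: transpose_def)
  then have "(\<Sum>X\<in>Pow U. (cmod (\<phi> (transpose a b ` X)))\<^sup>2) = (\<Sum>X\<in>Pow U. (cmod (\<phi> X))\<^sup>2)"
    by (intro sum.reindex_bij_witness[where i = "image (transpose a b)" and j = "image (transpose a b)"])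
       (auto simp: image_comp)
  then show ?thesis
    by (simp add: norm_on_def L2_set_def)
qed

section \<open>Adjoints of the intertwiners and of the pair Hamiltonian\<close>

lemma rmat_self_adjoint:
  assumes "a \<in> U" "b \<in> U"
  shows "inner_on U \<phi> (rmat e h a b \<psi>) = inner_on U (rmat e h a b \<phi>) \<psi>"
proof -
  have "transpose a b x \<in> U" if "x \<in> U" for x
    using assms that by (auto simp: transpose_def)
  then have "(\<Sum>X\<in>Pow U. cnj (\<phi> X) * \<psi> (transpose a b ` X)) =
      (\<Sum>X\<in>Pow U. cnj (\<phi> (transpose a b ` X)) * \<psi> X)"
    by (intro sum.reindex_bij_witness[where i = "image (transpose a b)" and j = "image (transpose a b)"])
       (auto simp: image_comp)
  then have "inner_on U \<phi> (\<lambda>X. \<psi> (transpose a b ` X)) = inner_on U (\<lambda>X. \<phi> (transpose a b ` X)) \<psi>"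
    by (simp add: inner_on_def)
  then show ?thesis
    by (simp add: rmat_def inner_on_linear)
qed

lemma move_adjoint:
  assumes "x \<in> U" "set l \<subseteq> U"
  shows "inner_on U \<phi> (move (rmat e h) x l \<psi>) = inner_on U (move (rmat e h) x (rev l) \<phi>) \<psi>"
  using assms(2) by (induction l arbitrary: \<psi>) (simp_all add: move_append rmat_self_adjoint assms(1))

text \<open>The adjoint carries the same factors in the opposite order, another reduced word of the
  same permutation. Both words give the same operator by \<open>reversal_exchange\<close> for the
  family of moves.\<close>

lemma reversal_self_adjoint:
  assumes "distinct l" "set l \<subseteq> U"
  shows "inner_on U \<phi> (reversal (rmat e h) l \<psi>) = inner_on U (reversal (rmat e h) l \<phi>) \<psi>"
  using assms
proof (induction l arbitrary: \<phi> \<psi>)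
  case (Cons x l)
  let ?R = "rmat e h"
  have "reversal ?R l (move ?R x (l @ []) \<phi>) = move ?R x (rev l @ []) (reversal ?R l \<phi>)"
    using Cons.prems by (intro reversal_exchange[OF exchanges_move]) auto
  then show ?case
    using Cons by (simp add: move_adjoint)
qed simp

lemma hop_adjoint:
  assumes "finite U" "j \<in> U" "k \<in> U"
  shows "inner_on U \<phi> (hop j k \<psi>) = inner_on U (hop k j \<phi>) \<psi>"
proof -
  have "inner_on U \<phi> (hop j k \<psi>) =
      (\<Sum>X\<in>{X\<in>Pow U. k \<in> X \<and> j \<notin> X}. cnj (\<phi> X) * \<psi> (insert j (X - {k})))"
    unfolding inner_on_def by (rule sum.mono_neutral_cong_right) (use assms in \<open>auto simp: hop_def\<close>)
  also have "\<dots> = (\<Sum>X\<in>{X\<in>Pow U. j \<in> X \<and> k \<notin> X}. cnj (\<phi> (insert k (X - {j}))) * \<psi> X)"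
    by (rule sum.reindex_bij_witness[where i = "\<lambda>X. insert k (X - {j})" and j = "\<lambda>X. insert j (X - {k})"])
       (use assms in \<open>auto simp: insert_absorb\<close>)
  also have "\<dots> = inner_on U (hop k j \<phi>) \<psi>"
    unfolding inner_on_def by (rule sum.mono_neutral_cong_left) (use assms in \<open>auto simp: hop_def\<close>)
  finally show ?thesis .
qed

text \<open>The adjoint of a hop is the opposite hop, so taking adjoints swaps \<open>Gp\<close> and
  \<open>Gm\<close>, and so does reversing the list.\<close>

lemma hops_adjoint:
  assumes "finite U" "set l \<subseteq> U"
  shows "inner_on U \<phi> (hops Gp Gm l \<psi>) = inner_on U (hops Gp Gm (rev l) \<phi>) \<psi>"
  using assms(2)
proof (induction l)
  case Nil
  then show ?case
    by (simp add: inner_on_def)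
next
  case (Cons x l)
  have "inner_on U \<phi> (\<lambda>X. \<Sum>k\<leftarrow>m. of_real Gp * hop x k \<psi> X + of_real Gm * hop k x \<psi> X) =
      inner_on U (\<lambda>X. \<Sum>k\<leftarrow>rev m. of_real Gp * hop k x \<phi> X + of_real Gm * hop x k \<phi> X) \<psi>"
    if "set m \<subseteq> U" for m
    using that Cons.prems assms(1)
    by (induction m) (simp_all add: inner_on_linear hop_adjoint)
  moreover have "hops Gp Gm (x # l) \<psi> = (\<lambda>X. (\<Sum>k\<leftarrow>l. of_real Gp * hop x k \<psi> X + of_real Gm * hop k x \<psi> X)
      + hops Gp Gm l \<psi> X)"
    by (simp add: fun_eq_iff)
  moreover have "hops Gp Gm (rev (x # l)) \<phi> = (\<lambda>X. hops Gp Gm (rev l) \<phi> X +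
      (\<Sum>k\<leftarrow>rev l. of_real Gp * hop k x \<phi> X + of_real Gm * hop x k \<phi> X))"
    by (simp add: fun_eq_iff hops_append_snoc)
  ultimately show ?case
    using Cons by (simp add: inner_on_linear)
qed

lemma pair_ham_adjoint:
  assumes "finite U" "set l \<subseteq> U"
  shows "inner_on U \<phi> (pair_ham e Gp Gm l \<psi>) = inner_on U (pair_ham e Gp Gm (rev l) \<phi>) \<psi>"
proof -
  define E where "E = pair_energy (\<lambda>j. 2 * e j - (Gp + Gm) / 2) l"
  have "pair_energy (\<lambda>j. 2 * e j - (Gp + Gm) / 2) (rev l) = E"
    by (simp add: pair_energy_def E_def fun_eq_iff rev_map[symmetric] sum_list_rev)
  then have "pair_ham e Gp Gm (rev l) \<phi> = (\<lambda>X. of_real (E X) * \<phi> X - hops Gp Gm (rev l) \<phi> X)"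
    by (simp add: pair_ham_def fun_eq_iff)
  moreover have "pair_ham e Gp Gm l \<psi> = (\<lambda>X. of_real (E X) * \<psi> X - hops Gp Gm l \<psi> X)"
    by (simp add: pair_ham_def fun_eq_iff E_def)
  moreover have "inner_on U \<phi> (\<lambda>X. of_real (E X) * \<psi> X) = inner_on U (\<lambda>X. of_real (E X) * \<phi> X) \<psi>"
    by (simp add: inner_on_def algebra_simps)
  ultimately show ?thesis
    by (simp add: inner_on_linear hops_adjoint[OF assms])
qed

section \<open>Positivity\<close>

text \<open>Invertibility is expressed by a lower bound uniform in \<open>t\<close>. Together with
  the upper and the Lipschitz bound it passes to compositions, so it only has to be checked for a
  single R-matrix.\<close>

definition invertible_homotopy :: "'a set \<Rightarrow> (real \<Rightarrow> 'a oper) \<Rightarrow> bool" where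
  "invertible_homotopy U F \<longleftrightarrow>
     (\<forall>t \<phi> \<psi>. F t (\<lambda>X. \<phi> X - \<psi> X) = (\<lambda>X. F t \<phi> X - F t \<psi> X)) \<and>
     (\<forall>t c \<phi>. F t (\<lambda>X. c * \<phi> X) = (\<lambda>X. c * F t \<phi> X)) \<and>
     (\<exists>c>0. \<forall>t\<in>{0..1}. \<forall>\<phi>. c * norm_on U \<phi> \<le> norm_on U (F t \<phi>)) \<and>
     (\<exists>M>0. \<forall>t\<in>{0..1}. \<forall>\<phi>. norm_on U (F t \<phi>) \<le> M * norm_on U \<phi>) \<and>
     (\<exists>K>0. \<forall>s\<in>{0..1}. \<forall>t\<in>{0..1}. \<forall>\<phi>.
        norm_on U (\<lambda>X. F s \<phi> X - F t \<phi> X) \<le> K * \<bar>s - t\<bar> * norm_on U \<phi>)"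

lemma tameI:
  assumes "\<And>t \<phi> \<psi>. F t (\<lambda>X. \<phi> X - \<psi> X) = (\<lambda>X. F t \<phi> X - F t \<psi> X)"
    and "\<And>t c \<phi>. F t (\<lambda>X. c * \<phi> X) = (\<lambda>X. c * F t \<phi> X)"
    and "c > 0" "\<And>t \<phi>. t \<in> {0..1} \<Longrightarrow> c * norm_on U \<phi> \<le> norm_on U (F t \<phi>)"
    and "M > 0" "\<And>t \<phi>. t \<in> {0..1} \<Longrightarrow> norm_on U (F t \<phi>) \<le> M * norm_on U \<phi>"
    and "K > 0" "\<And>s t \<phi>. s \<in> {0..1} \<Longrightarrow> t \<in> {0..1} \<Longrightarrow>
        norm_on U (\<lambda>X. F s \<phi> X - F t \<phi> X) \<le> K * \<bar>s - t\<bar> * norm_on U \<phi>"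
  shows "invertible_homotopy U F"
  unfolding invertible_homotopy_def
proof (intro conjI)
  show "\<exists>c>0. \<forall>t\<in>{0..1}. \<forall>\<phi>. c * norm_on U \<phi> \<le> norm_on U (F t \<phi>)"
    using assms(3,4) by blast
  show "\<exists>M>0. \<forall>t\<in>{0..1}. \<forall>\<phi>. norm_on U (F t \<phi>) \<le> M * norm_on U \<phi>"
    using assms(5,6) by blast
  show "\<exists>K>0. \<forall>s\<in>{0..1}. \<forall>t\<in>{0..1}. \<forall>\<phi>.
        norm_on U (\<lambda>X. F s \<phi> X - F t \<phi> X) \<le> K * \<bar>s - t\<bar> * norm_on U \<phi>"
    using assms(7,8) by blast
qed (use assms(1,2) in blast)+

lemma invertible_homotopy_lower:
  "invertible_homotopy U F \<Longrightarrow> \<exists>c>0. \<forall>t\<in>{0..1}. \<forall>\<phi>. c * norm_on U \<phi> \<le> norm_on U (F t \<phi>)"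
  unfolding invertible_homotopy_def by blast

lemma invertible_homotopy_upper:
  "invertible_homotopy U F \<Longrightarrow> \<exists>M>0. \<forall>t\<in>{0..1}. \<forall>\<phi>. norm_on U (F t \<phi>) \<le> M * norm_on U \<phi>"
  unfolding invertible_homotopy_def by blast

lemma invertible_homotopy_lipschitz:
  "invertible_homotopy U F \<Longrightarrow> \<exists>K>0. \<forall>s\<in>{0..1}. \<forall>t\<in>{0..1}. \<forall>\<phi>.
     norm_on U (\<lambda>X. F s \<phi> X - F t \<phi> X) \<le> K * \<bar>s - t\<bar> * norm_on U \<phi>"
  unfolding invertible_homotopy_def by blast

lemma invertible_homotopy_diff: "invertible_homotopy U F \<Longrightarrow> F t (\<lambda>X. \<phi> X - \<psi> X) = (\<lambda>X. F t \<phi> X - F t \<psi> X)"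
  unfolding invertible_homotopy_def by blast

lemma invertible_homotopy_scale: "invertible_homotopy U F \<Longrightarrow> F t (\<lambda>X. c * \<phi> X) = (\<lambda>X. c * F t \<phi> X)"
  unfolding invertible_homotopy_def by blast

lemma invertible_homotopy_id: "invertible_homotopy U (\<lambda>t \<phi>. \<phi>)"
  by (rule tameI[of _ 1 U 1 1]) (auto simp: norm_on_def L2_set_def sum_nonneg)

text \<open>Lower and upper constants multiply; the Lipschitz constant follows the product
  rule.\<close>

lemma invertible_homotopy_comp:
  assumes "invertible_homotopy U F" "invertible_homotopy U G"
  shows "invertible_homotopy U (\<lambda>t \<phi>. F t (G t \<phi>))"
proof -
  obtain c where c: "c > 0" "\<forall>t\<in>{0..1}. \<forall>\<phi>. c * norm_on U \<phi> \<le> norm_on U (F t \<phi>)"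
    using invertible_homotopy_lower[OF assms(1)] by blast
  obtain M where M: "M > 0" "\<forall>t\<in>{0..1}. \<forall>\<phi>. norm_on U (F t \<phi>) \<le> M * norm_on U \<phi>"
    using invertible_homotopy_upper[OF assms(1)] by blast
  obtain K where K: "K > 0" "\<forall>s\<in>{0..1}. \<forall>t\<in>{0..1}. \<forall>\<phi>.
        norm_on U (\<lambda>X. F s \<phi> X - F t \<phi> X) \<le> K * \<bar>s - t\<bar> * norm_on U \<phi>"
    using invertible_homotopy_lipschitz[OF assms(1)] by blast
  obtain c' where c': "c' > 0" "\<forall>t\<in>{0..1}. \<forall>\<phi>. c' * norm_on U \<phi> \<le> norm_on U (G t \<phi>)"
    using invertible_homotopy_lower[OF assms(2)] by blast
  obtain M' where M': "M' > 0" "\<forall>t\<in>{0..1}. \<forall>\<phi>. norm_on U (G t \<phi>) \<le> M' * norm_on U \<phi>"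
    using invertible_homotopy_upper[OF assms(2)] by blast
  obtain K' where K': "K' > 0" "\<forall>s\<in>{0..1}. \<forall>t\<in>{0..1}. \<forall>\<phi>.
        norm_on U (\<lambda>X. G s \<phi> X - G t \<phi> X) \<le> K' * \<bar>s - t\<bar> * norm_on U \<phi>"
    using invertible_homotopy_lipschitz[OF assms(2)] by blast
  have lower: "c * c' * norm_on U \<phi> \<le> norm_on U (F t (G t \<phi>))" if "t \<in> {0..1}" for t \<phi>
  proof -
    have "c * (c' * norm_on U \<phi>) \<le> c * norm_on U (G t \<phi>)"
      using c c' that by (intro mult_left_mono) auto
    also have "\<dots> \<le> norm_on U (F t (G t \<phi>))"
      using c(2) that by blast
    finally show ?thesis
      by (simp add: mult.assoc)
  qed
  have upper: "norm_on U (F t (G t \<phi>)) \<le> M * M' * norm_on U \<phi>" if "t \<in> {0..1}" for t \<phi>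
  proof -
    have "norm_on U (F t (G t \<phi>)) \<le> M * norm_on U (G t \<phi>)"
      using M(2) that by blast
    also have "\<dots> \<le> M * (M' * norm_on U \<phi>)"
      using M M' that by (intro mult_left_mono) auto
    finally show ?thesis
      by (simp add: mult.assoc)
  qed
  have lip: "norm_on U (\<lambda>X. F s (G s \<phi>) X - F t (G t \<phi>) X) \<le> (M * K' + K * M') * \<bar>s - t\<bar> * norm_on U \<phi>"
    if st: "s \<in> {0..1}" "t \<in> {0..1}" for s t \<phi>
  proof -
    have eq: "F s (\<lambda>X. G s \<phi> X - G t \<phi> X) = (\<lambda>X. F s (G s \<phi>) X - F s (G t \<phi>) X)"
      by (rule invertible_homotopy_diff[OF assms(1)])
    \<comment> \<open>The mixed term \<open>F s (G t \<phi>)\<close> separates the variation of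
      \<open>G\<close> from that of \<open>F\<close>.\<close>
    have "norm_on U (\<lambda>X. F s (G s \<phi>) X - F t (G t \<phi>) X) =
        norm_on U (\<lambda>X. (F s (G s \<phi>) X - F s (G t \<phi>) X) + (F s (G t \<phi>) X - F t (G t \<phi>) X))"
      by (rule arg_cong[where f = "norm_on U"]) (simp add: fun_eq_iff)
    also have "\<dots> \<le> norm_on U (F s (\<lambda>X. G s \<phi> X - G t \<phi> X)) + norm_on U (\<lambda>X. F s (G t \<phi>) X - F t (G t \<phi>) X)"
      unfolding eq by (rule norm_on_triangle)
    also have "\<dots> \<le> M * (K' * \<bar>s - t\<bar> * norm_on U \<phi>) + K * \<bar>s - t\<bar> * (M' * norm_on U \<phi>)"
    proof (rule add_mono)
      have "norm_on U (F s (\<lambda>X. G s \<phi> X - G t \<phi> X)) \<le> M * norm_on U (\<lambda>X. G s \<phi> X - G t \<phi> X)"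
        using M(2) st by blast
      also have "\<dots> \<le> M * (K' * \<bar>s - t\<bar> * norm_on U \<phi>)"
        using M K' st by (intro mult_left_mono) auto
      finally show "norm_on U (F s (\<lambda>X. G s \<phi> X - G t \<phi> X)) \<le> M * (K' * \<bar>s - t\<bar> * norm_on U \<phi>)" .
      have "norm_on U (\<lambda>X. F s (G t \<phi>) X - F t (G t \<phi>) X) \<le> K * \<bar>s - t\<bar> * norm_on U (G t \<phi>)"
        using K(2) st by blast
      also have "\<dots> \<le> K * \<bar>s - t\<bar> * (M' * norm_on U \<phi>)"
        using K M' st by (intro mult_left_mono) auto
      finally show "norm_on U (\<lambda>X. F s (G t \<phi>) X - F t (G t \<phi>) X) \<le> K * \<bar>s - t\<bar> * (M' * norm_on U \<phi>)" .
    qed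
    finally show ?thesis
      by (simp add: algebra_simps)
  qed
  have pos: "c * c' > 0" "M * M' > 0" "M * K' + K * M' > 0"
    using c c' M M' K K' by (simp_all add: add_pos_pos)
  show ?thesis
    by (rule tameI[OF _ _ pos(1) lower pos(2) upper pos(3) lip])
       (simp_all add: invertible_homotopy_diff[OF assms(1)] invertible_homotopy_diff[OF assms(2)] invertible_homotopy_scale[OF assms(1)] invertible_homotopy_scale[OF assms(2)])
qed

text \<open>Exchanging two sites is an isometry, so for \<open>t\<close> in the unit interval the
  exchange term has norm at most \<open>\<bar>h\<bar>\<close> times that of the state, which the
  scalar term dominates.\<close>

lemma invertible_homotopy_rmat:
  assumes "a \<in> U" "b \<in> U" "\<bar>h\<bar> < e b - e a"
  shows "invertible_homotopy U (\<lambda>t. rmat e (t * h) a b)"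
proof -
  let ?u = "e b - e a" and ?P = "\<lambda>\<phi> X. \<phi> (transpose a b ` X)"
  have P: "norm_on U (?P \<phi>) = norm_on U \<phi>" for \<phi>
    using assms by (intro norm_on_transpose)
  have th: "\<bar>t * h\<bar> \<le> \<bar>h\<bar>" if "t \<in> {0..1}" for t
    using that by (auto simp: abs_mult intro: mult_left_le_one_le)
  have lower: "(?u - \<bar>h\<bar>) * norm_on U \<phi> \<le> norm_on U (rmat e (t * h) a b \<phi>)" if "t \<in> {0..1}" for t \<phi>
  proof -
    have "norm_on U (\<lambda>X. of_real ?u * \<phi> X) =
        norm_on U (\<lambda>X. rmat e (t * h) a b \<phi> X + of_real (t * h) * ?P \<phi> X)"
      by (simp add: rmat_def)
    also have "\<dots> \<le> norm_on U (rmat e (t * h) a b \<phi>) + norm_on U (\<lambda>X. of_real (t * h) * ?P \<phi> X)"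
      by (rule norm_on_triangle)
    finally have "norm_on U (\<lambda>X. of_real ?u * \<phi> X) \<le>
        norm_on U (rmat e (t * h) a b \<phi>) + norm_on U (\<lambda>X. of_real (t * h) * ?P \<phi> X)" .
    then have "?u * norm_on U \<phi> \<le> norm_on U (rmat e (t * h) a b \<phi>) + \<bar>t * h\<bar> * norm_on U \<phi>"
      using assms(3) unfolding norm_on_scale P norm_of_real by simp
    moreover have "\<bar>t * h\<bar> * norm_on U \<phi> \<le> \<bar>h\<bar> * norm_on U \<phi>"
      using th[OF that] by (intro mult_right_mono) auto
    ultimately show ?thesis
      by (simp add: algebra_simps)
  qed
  have upper: "norm_on U (rmat e (t * h) a b \<phi>) \<le> (?u + \<bar>h\<bar>) * norm_on U \<phi>" if "t \<in> {0..1}" for t \<phi>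
  proof -
    have "norm_on U (rmat e (t * h) a b \<phi>) =
        norm_on U (\<lambda>X. of_real ?u * \<phi> X + of_real (- (t * h)) * ?P \<phi> X)"
      by (simp add: rmat_def)
    also have "\<dots> \<le> norm_on U (\<lambda>X. of_real ?u * \<phi> X) + norm_on U (\<lambda>X. of_real (- (t * h)) * ?P \<phi> X)"
      by (rule norm_on_triangle)
    finally have "norm_on U (rmat e (t * h) a b \<phi>) \<le>
        norm_on U (\<lambda>X. of_real ?u * \<phi> X) + norm_on U (\<lambda>X. of_real (- (t * h)) * ?P \<phi> X)" .
    then have "norm_on U (rmat e (t * h) a b \<phi>) \<le> ?u * norm_on U \<phi> + \<bar>t * h\<bar> * norm_on U \<phi>"
      using assms(3) unfolding norm_on_scale P norm_of_real by simp
    moreover have "\<bar>t * h\<bar> * norm_on U \<phi> \<le> \<bar>h\<bar> * norm_on U \<phi>"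
      using th[OF that] by (intro mult_right_mono) auto
    ultimately show ?thesis
      by (simp add: algebra_simps)
  qed
  \<comment> \<open>The constant is \<open>\<bar>h\<bar> + 1\<close> in order to be positive also
    for \<open>h = 0\<close>.\<close>
  have lip: "norm_on U (\<lambda>X. rmat e (s * h) a b \<phi> X - rmat e (t * h) a b \<phi> X) \<le>
      (\<bar>h\<bar> + 1) * \<bar>s - t\<bar> * norm_on U \<phi>" for s t \<phi>
  proof -
    have "(\<lambda>X. rmat e (s * h) a b \<phi> X - rmat e (t * h) a b \<phi> X) = (\<lambda>X. of_real ((t - s) * h) * ?P \<phi> X)"
      by (simp add: rmat_def algebra_simps)
    then have "norm_on U (\<lambda>X. rmat e (s * h) a b \<phi> X - rmat e (t * h) a b \<phi> X) = \<bar>s - t\<bar> * \<bar>h\<bar> * norm_on U \<phi>"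
      by (simp only: norm_on_scale P norm_of_real abs_mult abs_minus_commute)
    also have "\<dots> \<le> (\<bar>h\<bar> + 1) * \<bar>s - t\<bar> * norm_on U \<phi>"
      by (intro mult_right_mono) (auto simp: algebra_simps)
    finally show ?thesis .
  qed
  have pos: "0 < ?u - \<bar>h\<bar>" "0 < ?u + \<bar>h\<bar>" "0 < \<bar>h\<bar> + 1"
    using assms(3) by auto
  show ?thesis
    by (rule tameI[OF _ _ pos(1) lower pos(2) upper pos(3) lip]) (simp_all add: rmat_def algebra_simps)
qed

lemma invertible_homotopy_move:
  assumes "x \<in> U" "set l \<subseteq> U" "\<forall>y\<in>set l. \<bar>h\<bar> < e y - e x"
  shows "invertible_homotopy U (\<lambda>t. move (rmat e (t * h)) x l)"
  using assms(2,3)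
proof (induction l)
  case (Cons y l)
  then have "invertible_homotopy U (\<lambda>t \<phi>. move (rmat e (t * h)) x l (rmat e (t * h) x y \<phi>))"
    using assms(1) by (intro invertible_homotopy_comp[OF Cons.IH invertible_homotopy_rmat]) auto
  moreover have "move (rmat e (t * h)) x (y # l) = (\<lambda>\<phi>. move (rmat e (t * h)) x l (rmat e (t * h) x y \<phi>))" for t
    by (simp add: fun_eq_iff)
  ultimately show ?case
    by simp
next
  case Nil
  have "move (rmat e (t * h)) x [] = (\<lambda>\<phi>. \<phi>)" for t
    by (simp add: fun_eq_iff)
  then show ?case
    by (simp add: invertible_homotopy_id)
qed

lemma invertible_homotopy_reversal:
  assumes "set l \<subseteq> U" "sorted_wrt (\<lambda>x y. \<bar>h\<bar> < e y - e x) l"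
  shows "invertible_homotopy U (\<lambda>t. reversal (rmat e (t * h)) l)"
  using assms
proof (induction l)
  case (Cons x l)
  then have "invertible_homotopy U (\<lambda>t \<phi>. reversal (rmat e (t * h)) l (move (rmat e (t * h)) x l \<phi>))"
    by (intro invertible_homotopy_comp[OF Cons.IH invertible_homotopy_move]) auto
  moreover have "reversal (rmat e (t * h)) (x # l) =
      (\<lambda>\<phi>. reversal (rmat e (t * h)) l (move (rmat e (t * h)) x l \<phi>))" for t
    by (simp add: fun_eq_iff)
  ultimately show ?case
    by simp
next
  case Nil
  have "reversal (rmat e (t * h)) [] = (\<lambda>\<phi>. \<phi>)" for t
    by (simp add: fun_eq_iff)
  then show ?case
    by (simp add: invertible_homotopy_id)
qed

text \<open>In operator terms, \<open>0 \<le> W \<le> M\<close> gives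
  \<open>W\<^sup>2 \<le> M W\<close>, hence
  \<open>W \<ge> W\<^sup>2 / M \<ge> c\<^sup>2 / M\<close>.\<close>

lemma nonneg_form_lower_bound:
  assumes lin: "\<And>\<phi> \<psi>. W (\<lambda>X. \<phi> X - \<psi> X) = (\<lambda>X. W \<phi> X - W \<psi> X)"
    "\<And>c \<phi>. W (\<lambda>X. c * \<phi> X) = (\<lambda>X. c * W \<phi> X)"
    and sym: "\<And>\<phi> \<psi>. inner_on U \<phi> (W \<psi>) = inner_on U (W \<phi>) \<psi>"
    and pos: "\<And>\<phi>. 0 \<le> Re (inner_on U \<phi> (W \<phi>))"
    and M: "M > 0" "\<And>\<phi>. norm_on U (W \<phi>) \<le> M * norm_on U \<phi>"
    and c: "c > 0" "\<And>\<phi>. c * norm_on U \<phi> \<le> norm_on U (W \<phi>)"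
  shows "c\<^sup>2 / M * (norm_on U \<phi>)\<^sup>2 \<le> Re (inner_on U \<phi> (W \<phi>))"
proof -
  let ?B = "\<lambda>\<phi> \<psi>. inner_on U \<phi> (W \<psi>)" and ?s = "complex_of_real (1 / M)"
  define w where "w = W \<phi>"
  \<comment> \<open>Nonnegativity of the form at \<open>\<phi> - W \<phi> / M\<close>.\<close>
  have "?B (\<lambda>X. \<phi> X - ?s * w X) (\<lambda>X. \<phi> X - ?s * w X) =
      ?B \<phi> \<phi> - ?s * ?B \<phi> w - (?s * ?B w \<phi> - ?s * (?s * ?B w w))"
    unfolding lin inner_on_linear by (simp add: algebra_simps)
  moreover have "?B \<phi> w = of_real ((norm_on U w)\<^sup>2)" "?B w \<phi> = of_real ((norm_on U w)\<^sup>2)"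
    using sym[of \<phi> w] by (simp_all add: inner_on_self flip: w_def)
  ultimately have "Re (?B (\<lambda>X. \<phi> X - ?s * w X) (\<lambda>X. \<phi> X - ?s * w X)) =
      Re (?B \<phi> \<phi>) - 2 / M * (norm_on U w)\<^sup>2 + (1 / M)\<^sup>2 * Re (?B w w)"
    by (simp add: power2_eq_square flip: of_real_mult)
  with pos have *: "2 / M * (norm_on U w)\<^sup>2 \<le> Re (?B \<phi> \<phi>) + (1 / M)\<^sup>2 * Re (?B w w)"
    by (smt (verit))
  \<comment> \<open>By the upper bound the quadratic term costs at most \<open>1 / M\<close> times
    the squared norm of \<open>w\<close>, which leaves half of the \<open>2 / M\<close>.\<close>
  have "Re (?B w w) \<le> norm_on U w * norm_on U (W w)"
    by (rule order_trans[OF complex_Re_le_cmod cauchy_schwarz_on])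
  also have "\<dots> \<le> norm_on U w * (M * norm_on U w)"
    using M(2) by (intro mult_left_mono) auto
  finally have "(1 / M)\<^sup>2 * Re (?B w w) \<le> (1 / M)\<^sup>2 * (M * (norm_on U w)\<^sup>2)"
    by (intro mult_left_mono) (auto simp: power2_eq_square algebra_simps)
  also have "\<dots> = 1 / M * (norm_on U w)\<^sup>2"
    using M(1) by (simp add: power2_eq_square)
  finally have "1 / M * (norm_on U w)\<^sup>2 \<le> Re (?B \<phi> \<phi>)"
    using * by (simp add: field_simps)
  moreover have "c\<^sup>2 * (norm_on U \<phi>)\<^sup>2 \<le> (norm_on U w)\<^sup>2"
    using c power_mono[OF c(2)[of \<phi>], of 2] by (simp add: w_def power_mult_distrib)
  then have "1 / M * (c\<^sup>2 * (norm_on U \<phi>)\<^sup>2) \<le> 1 / M * (norm_on U w)\<^sup>2"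
    using M(1) by (intro mult_left_mono) auto
  ultimately show ?thesis
    by simp
qed

text \<open>Continuity method: wherever the form is nonnegative it is bounded below by a constant
  \<open>\<kappa>\<close> independent of \<open>t\<close>. Nonnegativity therefore persists over
  steps of a fixed length and reaches \<open>1\<close> after finitely many.\<close>

lemma invertible_homotopy_positive:
  assumes F: "invertible_homotopy U F" and sym: "\<And>t \<phi> \<psi>. inner_on U \<phi> (F t \<psi>) = inner_on U (F t \<phi>) \<psi>"
    and start: "\<And>\<phi>. 0 \<le> Re (inner_on U \<phi> (F 0 \<phi>))"
  shows "\<exists>\<kappa>>0. \<forall>\<phi>. \<kappa> * (norm_on U \<phi>)\<^sup>2 \<le> Re (inner_on U \<phi> (F 1 \<phi>))"
proof -
  obtain c where c: "c > 0" "\<forall>t\<in>{0..1}. \<forall>\<phi>. c * norm_on U \<phi> \<le> norm_on U (F t \<phi>)"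
    using invertible_homotopy_lower[OF F] by blast
  obtain M where M: "M > 0" "\<forall>t\<in>{0..1}. \<forall>\<phi>. norm_on U (F t \<phi>) \<le> M * norm_on U \<phi>"
    using invertible_homotopy_upper[OF F] by blast
  obtain K where K: "K > 0" "\<forall>s\<in>{0..1}. \<forall>t\<in>{0..1}. \<forall>\<phi>.
        norm_on U (\<lambda>X. F s \<phi> X - F t \<phi> X) \<le> K * \<bar>s - t\<bar> * norm_on U \<phi>"
    using invertible_homotopy_lipschitz[OF F] by blast
  define \<kappa> where "\<kappa> = c\<^sup>2 / M"
  have "\<kappa> > 0"
    using c M by (simp add: \<kappa>_def)
  have bound: "\<kappa> * (norm_on U \<phi>)\<^sup>2 \<le> Re (inner_on U \<phi> (F t \<phi>))"
    if "t \<in> {0..1}" "\<And>\<phi>. 0 \<le> Re (inner_on U \<phi> (F t \<phi>))" for t \<phi>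
    unfolding \<kappa>_def
    by (rule nonneg_form_lower_bound[where W = "F t"])
       (use that sym M c in \<open>auto simp: invertible_homotopy_diff[OF F] invertible_homotopy_scale[OF F]\<close>)
  have step: "0 \<le> Re (inner_on U \<phi> (F s \<phi>))"
    if t: "t \<in> {0..1}" "\<And>\<phi>. 0 \<le> Re (inner_on U \<phi> (F t \<phi>))" and s: "s \<in> {0..1}" "K * \<bar>s - t\<bar> \<le> \<kappa>"
    for s t \<phi>
  proof -
    have "Re (inner_on U \<phi> (F t \<phi>)) - Re (inner_on U \<phi> (F s \<phi>)) = - Re (inner_on U \<phi> (\<lambda>X. F s \<phi> X - F t \<phi> X))"
      by (simp add: inner_on_diff_right)
    also have "\<dots> \<le> norm_on U \<phi> * norm_on U (\<lambda>X. F s \<phi> X - F t \<phi> X)"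
      using cauchy_schwarz_on[of U \<phi> "\<lambda>X. F s \<phi> X - F t \<phi> X"]
        abs_Re_le_cmod[of "inner_on U \<phi> (\<lambda>X. F s \<phi> X - F t \<phi> X)"] by linarith
    also have "\<dots> \<le> norm_on U \<phi> * (\<kappa> * norm_on U \<phi>)"
    proof (rule mult_left_mono)
      have "norm_on U (\<lambda>X. F s \<phi> X - F t \<phi> X) \<le> K * \<bar>s - t\<bar> * norm_on U \<phi>"
        using K(2) s(1) t(1) by blast
      also have "\<dots> \<le> \<kappa> * norm_on U \<phi>"
        using s(2) by (intro mult_right_mono) auto
      finally show "norm_on U (\<lambda>X. F s \<phi> X - F t \<phi> X) \<le> \<kappa> * norm_on U \<phi>" .
    qed simp
    finally show ?thesis
      using bound[OF t, of \<phi>] by (simp add: power2_eq_square algebra_simps)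
  qed
  \<comment> \<open>Steps of length \<open>1 / n\<close> are short enough once
    \<open>n \<ge> K / \<kappa>\<close>; passing to \<open>Suc m\<close> makes \<open>n\<close>
    positive.\<close>
  obtain m :: nat where "K / \<kappa> \<le> real m"
    using real_arch_simple by blast
  then obtain n :: nat where n: "n > 0" "K / \<kappa> \<le> real n"
    by (intro that[of "Suc m"]) auto
  have "\<forall>\<phi>. 0 \<le> Re (inner_on U \<phi> (F (real i / real n) \<phi>))" if "i \<le> n" for i
    using that
  proof (induction i)
    case (Suc i)
    have "\<bar>real (Suc i) / real n - real i / real n\<bar> = 1 / real n"
      by (simp add: diff_divide_distrib[symmetric])
    moreover have "K * (1 / real n) \<le> \<kappa>"
      using n \<open>\<kappa> > 0\<close> by (simp add: field_simps)
    ultimately have close: "K * \<bar>real (Suc i) / real n - real i / real n\<bar> \<le> \<kappa>"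
      by (simp only:)
    have range: "real i / real n \<in> {0..1}" "real (Suc i) / real n \<in> {0..1}"
      using Suc.prems n(1) by (simp_all add: divide_le_eq_1)
    have "\<And>\<phi>. 0 \<le> Re (inner_on U \<phi> (F (real i / real n) \<phi>))"
      using Suc.IH Suc.prems by simp
    then show ?case
      by (intro allI step[OF range(1) _ range(2) close])
  qed (simp add: start)
  from this[of n] have "\<And>\<phi>. 0 \<le> Re (inner_on U \<phi> (F 1 \<phi>))"
    using n(1) by simp
  from bound[OF _ this] \<open>\<kappa> > 0\<close> show ?thesis
    by auto
qed

lemma rmat_zero: "rmat e 0 a b \<phi> = (\<lambda>X. of_real (e b - e a) * \<phi> X)"
  by (simp add: rmat_def)

text \<open>For \<open>h = 0\<close> every factor is a scalar \<open>e y - e x\<close>, positive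
  because \<open>x\<close> precedes \<open>y\<close>. This is the starting point of the
  homotopy.\<close>

lemma reversal_rmat_zero:
  assumes "sorted_wrt (\<lambda>x y. e x < e y) l"
  shows "\<exists>c\<ge>0. \<forall>\<phi>. reversal (rmat e 0) l \<phi> = (\<lambda>X. of_real c * \<phi> X)"
  using assms
proof (induction l)
  case Nil
  show ?case
    by (intro exI[of _ 1]) simp
next
  case (Cons x l)
  have scale: "\<exists>c\<ge>0. \<forall>\<phi>. move (rmat e 0) x m \<phi> = (\<lambda>X. of_real c * \<phi> X)" if "\<forall>y\<in>set m. e x < e y" for m
    using that
  proof (induction m)
    case Nil
    show ?case
      by (intro exI[of _ 1]) simp
  next
    case (Cons y m)
    then obtain c where c: "c \<ge> 0" "\<forall>\<phi>. move (rmat e 0) x m \<phi> = (\<lambda>X. of_real c * \<phi> X)"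
      by auto
    with Cons.prems show ?case
      by (intro exI[of _ "c * (e y - e x)"]) (simp_all add: rmat_zero[of e x y] mult.assoc)
  qed
  obtain c where c: "c \<ge> 0" "\<forall>\<phi>. move (rmat e 0) x l \<phi> = (\<lambda>X. of_real c * \<phi> X)"
    using scale[of l] Cons.prems by auto
  from Cons obtain d where "d \<ge> 0" "\<forall>\<phi>. reversal (rmat e 0) l \<phi> = (\<lambda>X. of_real d * \<phi> X)"
    by auto
  with c show ?case
    by (intro exI[of _ "d * c"]) (auto simp: mult.assoc)
qed

text \<open>Evaluate \<open>inner_on ?U \<phi> (?W 1 (?H l \<phi>))\<close> twice. Directly it is
  \<open>E\<close> times \<open>inner_on ?U \<phi> (?W 1 \<phi>)\<close>; moving the Hamiltonian
  through \<open>?W 1\<close> and over to the left argument gives \<open>cnj E\<close> times the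
  same nonzero number.\<close>

lemma pair_ham_eigenvalue_real:
  fixes l :: "'a list" and E :: complex
  assumes h: "Gp - Gm = 2 * h" and gap: "sorted_wrt (\<lambda>x y. \<bar>h\<bar> < e y - e x) l"
    and eig: "\<And>X. X \<subseteq> set l \<Longrightarrow> pair_ham e Gp Gm l \<phi> X = E * \<phi> X"
    and nz: "X0 \<subseteq> set l" "\<phi> X0 \<noteq> 0"
  shows "E \<in> \<real>"
proof -
  let ?U = "set l" and ?W = "\<lambda>t. reversal (rmat e (t * h)) l" and ?H = "pair_ham e Gp Gm"
  \<comment> \<open>A repeated entry would force \<open>\<bar>h\<bar> < 0\<close>.\<close>
  have dist: "distinct l"
    using gap by (induction l) auto
  have invertible_homotopy: "invertible_homotopy ?U ?W"
    by (rule invertible_homotopy_reversal[OF order_refl gap])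
  have sym: "inner_on ?U \<chi> (?W t \<psi>) = inner_on ?U (?W t \<chi>) \<psi>" for t \<chi> \<psi>
    by (rule reversal_self_adjoint[OF dist order_refl])
  have "sorted_wrt (\<lambda>x y. e x < e y) l"
    by (rule sorted_wrt_mono_rel[OF _ gap]) auto
  from reversal_rmat_zero[OF this] obtain d where d: "d \<ge> 0" "\<forall>\<phi>. ?W 0 \<phi> = (\<lambda>X. of_real d * \<phi> X)"
    by auto
  have "0 \<le> Re (inner_on ?U \<psi> (?W 0 \<psi>))" for \<psi>
    using d by (simp add: inner_on_scale_right inner_on_self flip: of_real_power of_real_mult)
  from invertible_homotopy_positive[OF invertible_homotopy sym this] obtain \<kappa> where \<kappa>: "\<kappa> > 0"
      "\<kappa> * (norm_on ?U \<phi>)\<^sup>2 \<le> Re (inner_on ?U \<phi> (?W 1 \<phi>))"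
    by blast
  have "cmod (\<phi> X0) \<le> norm_on ?U \<phi>"
    unfolding norm_on_def using nz by (intro member_le_L2_set) auto
  then have "norm_on ?U \<phi> > 0"
    using nz by (smt (verit) zero_less_norm_iff)
  with \<kappa> have B: "inner_on ?U \<phi> (?W 1 \<phi>) \<noteq> 0"
    by (smt (verit) mult_pos_pos zero_less_power zero_complex.sel(1))
  obtain M where M: "\<forall>t\<in>{0..1}. \<forall>\<phi>. norm_on ?U (?W t \<phi>) \<le> M * norm_on ?U \<phi>"
    using invertible_homotopy_upper[OF invertible_homotopy] by blast
  \<comment> \<open>The eigenvalue equation is known only inside \<open>?U\<close>, so the residual
    need not be the zero state. It has norm zero, and boundedness carries this through
    \<open>?W 1\<close>.\<close>
  let ?r = "\<lambda>X. ?H l \<phi> X - E * \<phi> X"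
  have "norm_on ?U ?r = 0"
    unfolding norm_on_def by (rule L2_set_0') (use eig in auto)
  moreover have "norm_on ?U (?W 1 ?r) \<le> M * norm_on ?U ?r"
    by (rule M[rule_format]) simp
  ultimately have r: "norm_on ?U (?W 1 ?r) = 0"
    by (intro antisym) simp_all
  have "cmod (inner_on ?U \<phi> (?W 1 ?r)) \<le> 0"
    using cauchy_schwarz_on[of ?U \<phi> "?W 1 ?r"] r by simp
  then have "inner_on ?U \<phi> (?W 1 (?H l \<phi>)) = E * inner_on ?U \<phi> (?W 1 \<phi>)"
    using invertible_homotopy_diff[OF invertible_homotopy, of 1 "?H l \<phi>" "\<lambda>X. E * \<phi> X"] invertible_homotopy_scale[OF invertible_homotopy, of 1 E \<phi>]
    by (simp add: inner_on_linear)
  moreover have "?W 1 (?H l \<phi>) = ?H (rev l) (?W 1 \<phi>)"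
    using reversal_exchange[OF exchanges_pair_ham[OF h], of l "[]"] dist by simp
  moreover have "inner_on ?U \<phi> (?H (rev l) (?W 1 \<phi>)) = inner_on ?U (?H l \<phi>) (?W 1 \<phi>)"
    using pair_ham_adjoint[of ?U "rev l" \<phi> e Gp Gm "?W 1 \<phi>"] by simp
  moreover have "inner_on ?U (?H l \<phi>) (?W 1 \<phi>) = inner_on ?U (\<lambda>X. E * \<phi> X) (?W 1 \<phi>)"
    unfolding inner_on_def by (rule sum.cong) (auto simp: eig)
  ultimately have "cnj E * inner_on ?U \<phi> (?W 1 \<phi>) = E * inner_on ?U \<phi> (?W 1 \<phi>)"
    by (simp add: inner_on_scale_left)
  with B show ?thesis
    by (simp add: Reals_cnj_iff)
qed

section \<open>Closedness of the reality of the spectrum\<close>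

text \<open>Every root is real and hence at distance at least \<open>\<bar>Im E\<bar>\<close> from
  \<open>E\<close>. The bound depends on the matrix only through its size, so it survives limits
  without any tracking of roots.\<close>

lemma char_poly_imaginary_bound:
  fixes A :: "complex mat"
  assumes A: "A \<in> carrier_mat n n" and real: "\<And>z. eigenvalue A z \<Longrightarrow> z \<in> \<real>"
  shows "\<bar>Im E\<bar> ^ n \<le> cmod (poly (char_poly A) E)"
proof -
  obtain as where as: "char_poly A = (\<Prod>a\<leftarrow>as. [:- a, 1:])" "length as = n"
    using char_poly_factorized[OF A] by blast
  have "a \<in> \<real>" if "a \<in> set as" for a
  proof -
    have "poly (char_poly A) a = 0"
      unfolding as(1) using that by (induction as) auto
    with real show ?thesis
      by (simp add: eigenvalue_root_char_poly[OF A])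
  qed
  then have "\<bar>Im E\<bar> ^ length as \<le> cmod (poly (\<Prod>a\<leftarrow>as. [:- a, 1:]) E)"
  proof (induction as)
    case (Cons a as)
    have "\<bar>Im E\<bar> \<le> cmod (E - a)"
      using abs_Im_le_cmod[of "E - a"] Cons.prems by (simp add: complex_is_Real_iff)
    with Cons have "\<bar>Im E\<bar> * \<bar>Im E\<bar> ^ length as \<le> cmod (E - a) * cmod (poly (\<Prod>a\<leftarrow>as. [:- a, 1:]) E)"
      by (intro mult_mono) auto
    also have "\<dots> = cmod (poly (\<Prod>a\<leftarrow>a # as. [:- a, 1:]) E)"
      by (simp add: algebra_simps flip: norm_mult)
    finally show ?case
      by simp
  qed simp
  with as show ?thesis
    by simp
qed

text \<open>Operators are given by kernels over a finite set, so that the enumeration required by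
  matrices stays inside the proof.\<close>

lemma eigenvalue_real_limit:
  fixes a :: "'a \<Rightarrow> 'a \<Rightarrow> complex" and d :: "'a \<Rightarrow> complex"
  assumes S: "finite S"
    and perturbed: "\<And>t v E x0. t > 0 \<Longrightarrow> x0 \<in> S \<Longrightarrow> v x0 \<noteq> 0 \<Longrightarrow>
      (\<And>x. x \<in> S \<Longrightarrow> (\<Sum>y\<in>S. a x y * v y) + of_real t * d x * v x = E * v x) \<Longrightarrow> E \<in> \<real>"
    and eig: "\<And>x. x \<in> S \<Longrightarrow> (\<Sum>y\<in>S. a x y * v y) = E * v x" and nz: "x0 \<in> S" "v x0 \<noteq> 0"
  shows "E \<in> \<real>"
proof -
  obtain f where f: "bij_betw f {0..<card S} S"
    using ex_bij_betw_nat_finite[OF S] by blast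
  define n where "n = card S"
  define g where "g = the_inv_into {0..<n} f"
  have fS: "f i \<in> S" and gf: "g (f i) = i" if "i < n" for i
    using that f by (auto simp: n_def g_def bij_betw_def the_inv_into_f_f)
  have gS: "g x < n" and fg: "f (g x) = x" if "x \<in> S" for x
    using that f the_inv_into_into[of f "{0..<n}" x "{0..<n}"]
    by (auto simp: n_def g_def bij_betw_def f_the_inv_into_f)
  have reindex: "(\<Sum>y\<in>S. F y) = (\<Sum>j\<in>{0..<n}. F (f j))" for F :: "'a \<Rightarrow> complex"
    using sum.reindex_bij_betw[OF f, of F] by (simp add: n_def)
  define M where "M t = mat n n (\<lambda>(i, j). a (f i) (f j) + (if i = j then of_real t * d (f i) else 0))" for t :: real
  have M: "M t \<in> carrier_mat n n" for t
    by (simp add: M_def)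
  have Mv: "(M t *\<^sub>v w) $ i = (\<Sum>y\<in>S. a (f i) y * w $ g y) + of_real t * d (f i) * w $ i"
    if "i < n" "w \<in> carrier_vec n" for t w i
  proof -
    have "(M t *\<^sub>v w) $ i = (\<Sum>j\<in>{0..<n}. (a (f i) (f j) + (if i = j then of_real t * d (f i) else 0)) * w $ j)"
      using that by (simp add: M_def scalar_prod_def)
    also have "\<dots> = (\<Sum>j\<in>{0..<n}. a (f i) (f j) * w $ j + (if i = j then of_real t * d (f i) * w $ i else 0))"
      by (rule sum.cong) (auto simp: algebra_simps)
    also have "\<dots> = (\<Sum>y\<in>S. a (f i) y * w $ g y) + of_real t * d (f i) * w $ i"
      using that by (simp add: sum.distrib reindex gf)
    finally show ?thesis .
  qed
  have real: "z \<in> \<real>" if tz: "t > 0" "eigenvalue (M t) z" for t z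
  proof -
    obtain w where w: "w \<in> carrier_vec n" "w \<noteq> 0\<^sub>v n" "M t *\<^sub>v w = z \<cdot>\<^sub>v w"
      using tz(2) M[of t] by (auto simp: eigenvalue_def eigenvector_def)
    then obtain i where i: "i < n" "w $ i \<noteq> 0"
      by (metis carrier_vecD eq_vecI index_zero_vec)
    show ?thesis
    proof (rule perturbed[OF tz(1), of "f i" "\<lambda>x. w $ g x"])
      show "(\<Sum>y\<in>S. a x y * w $ g y) + of_real t * d x * w $ g x = z * w $ g x" if "x \<in> S" for x
        using Mv[OF gS[OF that] w(1), of t] w that gS by (simp add: fg)
    qed (use i fS gf in auto)
  qed
  have "eigenvalue (M 0) E"
    unfolding eigenvalue_def eigenvector_def
  proof (intro exI conjI)
    let ?w = "vec n (\<lambda>i. v (f i))"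
    show "?w \<in> carrier_vec (dim_row (M 0))"
      by (simp add: M_def)
    have "?w $ g x0 \<noteq> 0\<^sub>v n $ g x0"
      using nz by (simp add: gS fg)
    then show "?w \<noteq> 0\<^sub>v (dim_row (M 0))"
      by (auto simp: M_def)
    show "M 0 *\<^sub>v ?w = E \<cdot>\<^sub>v ?w"
    proof (rule eq_vecI)
      fix i assume "i < dim_vec (E \<cdot>\<^sub>v ?w)"
      then have i: "i < n"
        by simp
      have "(\<Sum>y\<in>S. a (f i) y * ?w $ g y) = (\<Sum>y\<in>S. a (f i) y * v y)"
        by (rule sum.cong) (simp_all add: gS fg)
      then show "(M 0 *\<^sub>v ?w) $ i = (E \<cdot>\<^sub>v ?w) $ i"
        using Mv[OF i, of ?w 0] eig[OF fS[OF i]] i by simp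
    qed (simp add: M_def)
  qed
  then have zero: "poly (char_poly (M 0)) E = 0"
    by (simp add: eigenvalue_root_char_poly[OF M])
  \<comment> \<open>The Leibniz formula shows that the characteristic polynomial at the fixed point
    \<open>E\<close> is a polynomial in \<open>t\<close>, hence continuous.\<close>
  let ?e = "\<lambda>t i j. (if i = j then E else 0) - (a (f i) (f j) + (if i = j then of_real t * d (f i) else 0))"
  have "poly (char_poly (M t)) E = (\<Sum>p\<in>{p. p permutes {0..<n}}. signof p * (\<Prod>i=0..<n. ?e t i (p i)))" for t
  proof -
    have "- char_matrix (M t) E = mat n n (\<lambda>(i, j). ?e t i j)"
      by (rule eq_matI) (auto simp: char_matrix_def M_def)
    then have "poly (char_poly (M t)) E = det (mat n n (\<lambda>(i, j). ?e t i j))"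
      by (simp add: char_poly_matrix[OF M])
    also have "\<dots> = (\<Sum>p\<in>{p. p permutes {0..<n}}. signof p * (\<Prod>i=0..<n. ?e t i (p i)))"
      by (subst det_def'[of _ n]) (auto intro!: sum.cong prod.cong simp: permutes_in_image)
    finally show ?thesis .
  qed
  moreover have "isCont (\<lambda>t. if i = j then of_real t * d (f i) else 0) 0" for i j
    by (cases "i = j") (auto intro!: continuous_intros)
  ultimately have "isCont (\<lambda>t. cmod (poly (char_poly (M t)) E)) 0"
    by (simp only:) (intro continuous_intros)
  \<comment> \<open>Real eigenvalues are assumed for \<open>t > 0\<close> only, so the limit is
    taken from the right.\<close>
  then have "((\<lambda>t. cmod (poly (char_poly (M t)) E)) \<longlongrightarrow> cmod (poly (char_poly (M 0)) E)) (at_right 0)"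
    unfolding isCont_def by (rule filterlim_mono[OF _ order_refl at_le]) auto
  moreover have "eventually (\<lambda>t. \<bar>Im E\<bar> ^ n \<le> cmod (poly (char_poly (M t)) E)) (at_right 0)"
    using eventually_at_right_less by (rule eventually_mono) (rule char_poly_imaginary_bound[OF M], rule real)
  ultimately have "\<bar>Im E\<bar> ^ n \<le> cmod (poly (char_poly (M 0)) E)"
    by (rule tendsto_lowerbound) simp
  then have "Im E = 0"
    using zero by (auto simp: power_le_zero_eq)
  then show ?thesis
    by (simp add: complex_is_Real_iff)
qed

section \<open>Matrix entries of the pair Hamiltonian\<close>

lemma hop_kernel:
  assumes "finite U" "X \<subseteq> U" "j \<in> U"
  shows "hop j k \<phi> X = (\<Sum>Y\<in>Pow U. hop j k (\<lambda>Z. if Z = Y then 1 else 0) X * \<phi> Y)"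
proof (cases "k \<in> X \<and> j \<notin> X")
  case True
  have "(\<Sum>Y\<in>Pow U. hop j k (\<lambda>Z. if Z = Y then 1 else 0) X * \<phi> Y) =
      (\<Sum>Y\<in>Pow U. if insert j (X - {k}) = Y then \<phi> Y else 0)"
    by (rule sum.cong) (auto simp: hop_def True)
  \<comment> \<open>Here \<open>j \<in> U\<close> keeps the source configuration inside
    \<open>Pow U\<close>.\<close>
  also have "\<dots> = \<phi> (insert j (X - {k}))"
    using assms by (subst sum.delta') auto
  finally show ?thesis
    using True by (simp add: hop_def)
next
  case False
  then have "hop j k \<chi> X = 0" for \<chi>
    by (auto simp: hop_def)
  then show ?thesis
    by simp
qed

lemma hops_kernel:
  assumes "finite U" "X \<subseteq> U" "set l \<subseteq> U"
  shows "hops Gp Gm l \<phi> X = (\<Sum>Y\<in>Pow U. hops Gp Gm l (\<lambda>Z. if Z = Y then 1 else 0) X * \<phi> Y)"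
  using assms(3)
proof (induction l)
  case (Cons x l)
  let ?\<delta> = "\<lambda>Y Z. if Z = Y then 1 else 0 :: complex"
  have "(\<Sum>k\<leftarrow>m. of_real Gp * hop x k \<phi> X + of_real Gm * hop k x \<phi> X) =
      (\<Sum>Y\<in>Pow U. (\<Sum>k\<leftarrow>m. of_real Gp * hop x k (?\<delta> Y) X + of_real Gm * hop k x (?\<delta> Y) X) * \<phi> Y)"
    if "set m \<subseteq> U" for m
    using that
  proof (induction m)
    case (Cons k m)
    have "hop x k \<phi> X = (\<Sum>Y\<in>Pow U. hop x k (?\<delta> Y) X * \<phi> Y)" "hop k x \<phi> X = (\<Sum>Y\<in>Pow U. hop k x (?\<delta> Y) X * \<phi> Y)"
      by (rule hop_kernel[OF assms(1,2)]; use Cons.prems \<open>set (x # l) \<subseteq> U\<close> in simp)+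
    then show ?case
      using Cons by (simp only: list.map sum_list.Cons ring_distribs sum.distrib sum_distrib_left mult.assoc
          list.set insert_subset)
  qed simp
  with Cons show ?case
    by (simp add: ring_distribs sum.distrib)
qed simp

text \<open>Supplies the kernel for \<open>eigenvalue_real_limit\<close>: the entry at
  \<open>X\<close> and \<open>Y\<close> is the value at \<open>X\<close> of the image of the basis
  state of \<open>Y\<close>.\<close>

lemma pair_ham_kernel:
  assumes "finite U" "X \<subseteq> U" "set l \<subseteq> U"
  shows "pair_ham e Gp Gm l \<phi> X = (\<Sum>Y\<in>Pow U. pair_ham e Gp Gm l (\<lambda>Z. if Z = Y then 1 else 0) X * \<phi> Y)"
proof -
  let ?d = "complex_of_real (pair_energy (\<lambda>j. 2 * e j - (Gp + Gm) / 2) l X)"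
  have "(\<Sum>Y\<in>Pow U. pair_ham e Gp Gm l (\<lambda>Z. if Z = Y then 1 else 0) X * \<phi> Y) =
      (\<Sum>Y\<in>Pow U. (if X = Y then ?d * \<phi> Y else 0) - hops Gp Gm l (\<lambda>Z. if Z = Y then 1 else 0) X * \<phi> Y)"
    by (rule sum.cong) (auto simp: pair_ham_def algebra_simps)
  also have "\<dots> = ?d * \<phi> X - hops Gp Gm l \<phi> X"
    using assms by (simp add: sum_subtractf hops_kernel[symmetric])
  finally show ?thesis
    by (simp add: pair_ham_def)
qed

text \<open>The couplings stay fixed, so stretching the levels adds a diagonal term linear in
  \<open>t\<close>, the perturbation treated by \<open>eigenvalue_real_limit\<close>.\<close>

lemma pair_ham_rescale:
  "pair_ham (\<lambda>j. (1 + t) * e j) Gp Gm l \<phi> X =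
   pair_ham e Gp Gm l \<phi> X + of_real t * of_real (pair_energy (\<lambda>j. 2 * e j) l X) * \<phi> X"
proof -
  have "pair_energy (\<lambda>j. 2 * ((1 + t) * e j) - (Gp + Gm) / 2) l X =
      pair_energy (\<lambda>j. 2 * e j - (Gp + Gm) / 2) l X + t * pair_energy (\<lambda>j. 2 * e j) l X"
    unfolding pair_energy_def by (induction l) (auto simp: algebra_simps)
  then show ?thesis
    by (simp add: pair_ham_def algebra_simps)
qed

lemma pair_ham_eigenvalue_real_closed:
  fixes l :: "'a list" and E :: complex
  assumes h: "Gp - Gm = 2 * h" "h \<noteq> 0" and gap: "sorted_wrt (\<lambda>x y. \<bar>h\<bar> \<le> e y - e x) l"
    and eig: "\<And>X. X \<subseteq> set l \<Longrightarrow> pair_ham e Gp Gm l \<phi> X = E * \<phi> X"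
    and nz: "X0 \<subseteq> set l" "\<phi> X0 \<noteq> 0"
  shows "E \<in> \<real>"
proof (rule eigenvalue_real_limit[where S = "Pow (set l)" and v = \<phi> and ?x0.0 = X0
    and a = "\<lambda>X Y. pair_ham e Gp Gm l (\<lambda>Z. if Z = Y then 1 else 0) X"
    and d = "\<lambda>X. of_real (pair_energy (\<lambda>j. 2 * e j) l X)"])
  fix t :: real and v E' X1
  assume t: "t > 0" and X1: "X1 \<in> Pow (set l)" "v X1 \<noteq> 0"
    and ev: "\<And>X. X \<in> Pow (set l) \<Longrightarrow>
      (\<Sum>Y\<in>Pow (set l). pair_ham e Gp Gm l (\<lambda>Z. if Z = Y then 1 else 0) X * v Y)
      + of_real t * of_real (pair_energy (\<lambda>j. 2 * e j) l X) * v X = E' * v X"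
  show "E' \<in> \<real>"
  proof (rule pair_ham_eigenvalue_real[OF h(1), of "\<lambda>j. (1 + t) * e j"])
    have "\<bar>h\<bar> < (1 + t) * e y - (1 + t) * e x" if "\<bar>h\<bar> \<le> e y - e x" for x y
    proof -
      \<comment> \<open>Since \<open>h\<close> is nonzero, the gap \<open>e y - e x\<close> is
        positive and grows strictly under stretching.\<close>
      have "0 < t * (e y - e x)"
        using that h(2) t by (intro mult_pos_pos) auto
      with that show ?thesis
        by (simp add: algebra_simps)
    qed
    then show "sorted_wrt (\<lambda>x y. \<bar>h\<bar> < (1 + t) * e y - (1 + t) * e x) l"
      by (rule sorted_wrt_mono_rel[OF _ gap])
    show "pair_ham (\<lambda>j. (1 + t) * e j) Gp Gm l v X = E' * v X" if "X \<subseteq> set l" for X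
      unfolding pair_ham_rescale using ev[of X] that pair_ham_kernel[of "set l" X l e Gp Gm v] by simp
  qed (use X1 in auto)
next
  show "(\<Sum>Y\<in>Pow (set l). pair_ham e Gp Gm l (\<lambda>Z. if Z = Y then 1 else 0) X * \<phi> Y) = E * \<phi> X"
    if "X \<in> Pow (set l)" for X
    using eig[of X] that pair_ham_kernel[of "set l" X l e Gp Gm \<phi>] by simp
qed (use nz in auto)

section \<open>Reduction to the pairs on unblocked levels\<close>

lemma create_annih: "create m (annih m \<psi>) S = (if m \<in> S then \<psi> S else 0)"
  by (simp add: create_def annih_def jw_sign_remove insert_absorb flip: mult.assoc)

lemma number_apply:
  "number j \<psi> S = ((if (j, Plus) \<in> S then 1 else 0) + (if (j, Minus) \<in> S then 1 else 0)) * \<psi> S"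
  by (simp add: number_def create_annih)

section \<open>Cancellation of the Jordan--Wigner signs for pairs\<close>

lemma jw_sign_Minus:
  assumes "(j, Plus) \<notin> S"
  shows "jw_sign (j, Minus) S = jw_sign (j, Plus) S"
proof -
  have "{n \<in> S. precedes n (j, Minus)} = {n \<in> S. precedes n (j, Plus)}"
    using assms by (auto simp: precedes_def)
  then show ?thesis
    by (simp add: jw_sign_def)
qed

lemma jw_sign_Plus_insert_Minus: "jw_sign (j, Plus) (insert (j, Minus) S) = jw_sign (j, Plus) S"
proof -
  have "{n \<in> insert (j, Minus) S. precedes n (j, Plus)} = {n \<in> S. precedes n (j, Plus)}"
    by (auto simp: precedes_def)
  then show ?thesis
    by (simp add: jw_sign_def)
qed

text \<open>The two modes of a level are neighbours in the order, so both operators pick up the same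
  sign and it squares away: pairs behave as hard-core bosons.\<close>

lemma annih_pair:
  "annih (j, Minus) (annih (j, Plus) \<psi>) S =
   (if (j, Plus) \<in> S \<or> (j, Minus) \<in> S then 0 else \<psi> (insert (j, Plus) (insert (j, Minus) S)))"
  by (simp add: annih_def jw_sign_Minus jw_sign_Plus_insert_Minus flip: mult.assoc)

lemma create_pair:
  "create (k, Plus) (create (k, Minus) \<psi>) S =
   (if (k, Plus) \<in> S \<and> (k, Minus) \<in> S then \<psi> (S - {(k, Plus), (k, Minus)}) else 0)"
proof -
  have "jw_sign (k, Minus) (S - {(k, Plus)}) = jw_sign (k, Plus) S"
    by (simp add: jw_sign_Minus jw_sign_remove)
  moreover have "S - {(k, Plus)} - {(k, Minus)} = S - {(k, Plus), (k, Minus)}"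
    by auto
  ultimately show ?thesis
    by (simp add: create_def flip: mult.assoc)
qed

section \<open>Sectors with fixed singly occupied levels\<close>

definition unblocked :: "nat \<Rightarrow> mode set \<Rightarrow> nat set" where
  "unblocked L S = {j \<in> {1..L}. (j, Plus) \<in> S \<longleftrightarrow> (j, Minus) \<in> S}"

text \<open>The unpaired particles of \<open>S\<close> stay and the pairs sit exactly on
  \<open>X\<close>. For \<open>X\<close> ranging over the subsets of \<open>unblocked L S\<close>,
  the Hamiltonian couples these configurations only among themselves.\<close>

definition with_pairs :: "nat \<Rightarrow> mode set \<Rightarrow> nat set \<Rightarrow> mode set" where
  "with_pairs L S X = {m \<in> S. fst m \<notin> unblocked L S} \<union> X \<times> UNIV"

lemma spin_UNIV: "(UNIV :: spin set) = {Plus, Minus}"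
  using spin.exhaust by auto

lemma with_pairs_mem:
  assumes "X \<subseteq> unblocked L S"
  shows "(k, \<sigma>) \<in> with_pairs L S X \<longleftrightarrow> (if k \<in> unblocked L S then k \<in> X else (k, \<sigma>) \<in> S)"
  using assms by (auto simp: with_pairs_def)

lemma with_pairs_self:
  assumes "S \<subseteq> modes L"
  shows "with_pairs L S {j \<in> unblocked L S. (j, Plus) \<in> S} = S"
proof -
  have "(k, \<sigma>) \<in> with_pairs L S {j \<in> unblocked L S. (j, Plus) \<in> S} \<longleftrightarrow> (k, \<sigma>) \<in> S" for k \<sigma>
    by (subst with_pairs_mem) (cases \<sigma>; auto simp: unblocked_def)+
  then show ?thesis
    by auto
qed

lemma with_pairs_remove:
  assumes "k \<in> unblocked L S"
  shows "with_pairs L S X - {(k, Plus), (k, Minus)} = with_pairs L S (X - {k})"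
  using assms by (auto simp: with_pairs_def spin_UNIV)

lemma with_pairs_insert:
  "insert (k, Plus) (insert (k, Minus) (with_pairs L S X)) = with_pairs L S (insert k X)"
  by (auto simp: with_pairs_def spin_UNIV)

text \<open>A blocked level holds exactly one particle and can neither give nor take a pair. The
  condition \<open>j \<notin> X - {k}\<close>, in place of \<open>j \<notin> X\<close>, admits
  \<open>j = k\<close>, where the pair is put back.\<close>

lemma pair_hop_with_pairs:
  assumes "X \<subseteq> unblocked L S" "j \<in> {1..L}" "k \<in> {1..L}"
  shows "create (k, Plus) (create (k, Minus) (annih (j, Minus) (annih (j, Plus) \<psi>))) (with_pairs L S X) =
    (if j \<in> unblocked L S \<and> k \<in> unblocked L S \<and> k \<in> X \<and> j \<notin> X - {k}
     then \<psi> (with_pairs L S (insert j (X - {k}))) else 0)"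
proof -
  have k: "(k, Plus) \<in> with_pairs L S X \<and> (k, Minus) \<in> with_pairs L S X \<longleftrightarrow> k \<in> unblocked L S \<and> k \<in> X"
    using assms by (auto simp: with_pairs_mem unblocked_def)
  have "X - {k} \<subseteq> unblocked L S"
    using assms by auto
  then have j: "(j, Plus) \<in> with_pairs L S (X - {k}) \<or> (j, Minus) \<in> with_pairs L S (X - {k}) \<longleftrightarrow>
      j \<notin> unblocked L S \<or> j \<in> X - {k}"
    using assms by (auto simp: with_pairs_mem unblocked_def)
  show ?thesis
    unfolding create_pair annih_pair k using j
    by (auto simp: with_pairs_remove with_pairs_insert)
qed

text \<open>In an increasing list the order of positions is the order of the indices, so the
  recursion becomes the double sum of the Hamiltonian without its diagonal.\<close>

lemma hops_sorted:
  assumes "sorted_wrt (<) (l :: nat list)"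
  shows "hops Gp Gm l \<phi> X =
    (\<Sum>j\<in>set l. \<Sum>k\<in>set l. if j = k then 0 else of_real (coupling Gp Gm j k) * hop j k \<phi> X)"
  using assms
proof (induction l)
  case (Cons x l)
  let ?F = "\<lambda>j k. if j = k then 0 else of_real (coupling Gp Gm j k) * hop j k \<phi> X"
  have x: "x \<notin> set l" "\<And>k. k \<in> set l \<Longrightarrow> x < k" and dist: "distinct l"
    using Cons.prems strict_sorted_imp_sorted strict_sorted_iff by auto
  have "(\<Sum>k\<leftarrow>l. of_real Gp * hop x k \<phi> X + of_real Gm * hop k x \<phi> X) =
      (\<Sum>k\<in>set l. of_real Gp * hop x k \<phi> X + of_real Gm * hop k x \<phi> X)"
    by (rule sum_list_distinct_conv_sum_set[OF dist])
  also have "\<dots> = (\<Sum>k\<in>set l. ?F x k + ?F k x)"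
    by (rule sum.cong) (use x in \<open>fastforce simp: coupling_def\<close>)+
  finally show ?case
    using Cons x by (simp add: sum.distrib algebra_simps)
qed simp

text \<open>The singly occupied levels contribute a constant. On the others the level energies and
  the diagonal couplings combine into the pair energy, and the remaining couplings are the
  hops.\<close>

lemma hamiltonian_with_pairs:
  fixes L S \<psi>
  defines "U \<equiv> unblocked L S" and "\<phi> \<equiv> \<lambda>X. \<psi> (with_pairs L S X)"
  assumes X: "X \<subseteq> U"
  shows "hamiltonian L \<delta> Gp Gm \<psi> (with_pairs L S X) =
    of_real (\<Sum>j\<in>{1..L} - U. level L \<delta> j) * \<phi> X
    + pair_ham (level L \<delta>) Gp Gm (sorted_list_of_set U) \<phi> X"
proof -
  have fin: "finite U" and UL: "U \<subseteq> {1..L}"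
    by (auto simp: U_def unblocked_def)
  let ?e = "level L \<delta>" and ?l = "sorted_list_of_set U" and ?g = "(Gp + Gm) / 2"
  \<comment> \<open>A level outside \<open>U\<close> is singly occupied; one in \<open>U\<close>
    holds two particles or none.\<close>
  have num: "number j \<psi> (with_pairs L S X) = (if j \<in> U then if j \<in> X then 2 else 0 else 1) * \<phi> X"
    if "j \<in> {1..L}" for j
    using that X by (auto simp: number_apply with_pairs_mem U_def \<phi>_def) (auto simp: unblocked_def)
  have "(\<Sum>j=1..L. of_real (?e j) * number j \<psi> (with_pairs L S X)) =
      (\<Sum>j=1..L. of_real (?e j) * (if j \<in> U then if j \<in> X then 2 else 0 else 1)) * \<phi> X"
    unfolding sum_distrib_right by (rule sum.cong) (auto simp: num)
  also have "(\<Sum>j=1..L. of_real (?e j) * (if j \<in> U then if j \<in> X then 2 else 0 else 1)) =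
      (\<Sum>j\<in>{1..L} - U. of_real (?e j) * (if j \<in> U then if j \<in> X then 2 else 0 else (1::complex))) +
      (\<Sum>j\<in>U. of_real (?e j) * (if j \<in> U then if j \<in> X then 2 else 0 else 1))"
    by (rule sum.subset_diff[OF UL]) simp
  also have "\<dots> = of_real (\<Sum>j\<in>{1..L} - U. ?e j) + of_real (\<Sum>j\<in>U. if j \<in> X then 2 * ?e j else 0)"
    unfolding of_real_sum by (intro arg_cong2[where f = plus] sum.cong) auto
  finally have kin: "(\<Sum>j=1..L. of_real (?e j) * number j \<psi> (with_pairs L S X)) =
      of_real (\<Sum>j\<in>{1..L} - U. ?e j) * \<phi> X + of_real (\<Sum>j\<in>U. if j \<in> X then 2 * ?e j else 0) * \<phi> X"
    by (simp add: algebra_simps)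
  let ?T = "\<lambda>j k. of_real (coupling Gp Gm j k) *
      create (k, Plus) (create (k, Minus) (annih (j, Minus) (annih (j, Plus) \<psi>))) (with_pairs L S X)"
  have T: "?T j k = (if j = k then if j \<in> X then of_real ?g * \<phi> X else 0
      else of_real (coupling Gp Gm j k) * hop j k \<phi> X)" if "j \<in> U" "k \<in> U" for j k
    using that X UL by (subst pair_hop_with_pairs) (auto simp: U_def \<phi>_def hop_def coupling_def insert_absorb)
  \<comment> \<open>Blocked levels drop out, which restricts both sums to \<open>U\<close>.\<close>
  have T0: "?T j k = 0" if "j \<in> {1..L}" "k \<in> {1..L}" "j \<notin> U \<or> k \<notin> U" for j k
    using that X by (subst pair_hop_with_pairs) (auto simp: U_def)
  have "(\<Sum>j=1..L. \<Sum>k=1..L. ?T j k) = (\<Sum>j\<in>U. \<Sum>k=1..L. ?T j k)"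
  proof (rule sum.mono_neutral_right)
    show "\<forall>j\<in>{1..L} - U. (\<Sum>k=1..L. ?T j k) = 0"
      using T0 by (blast intro: sum.neutral)
  qed (use UL in auto)
  also have "\<dots> = (\<Sum>j\<in>U. \<Sum>k\<in>U. ?T j k)"
  proof (rule sum.cong[OF refl], rule sum.mono_neutral_right)
    show "\<forall>k\<in>{1..L} - U. ?T j k = 0" if "j \<in> U" for j
      using T0 UL that by blast
  qed (use UL in auto)
  also have "\<dots> = (\<Sum>j\<in>U. \<Sum>k\<in>U. (if j = k then if j \<in> X then of_real ?g * \<phi> X else 0 else 0)
      + (if j = k then 0 else of_real (coupling Gp Gm j k) * hop j k \<phi> X))"
    by (intro sum.cong refl) (simp add: T)
  also have "\<dots> = (\<Sum>j\<in>U. if j \<in> X then of_real ?g * \<phi> X else 0) + hops Gp Gm ?l \<phi> X"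
    using fin by (simp add: sum.distrib hops_sorted strict_sorted_list_of_set)
  also have "(\<Sum>j\<in>U. if j \<in> X then of_real ?g * \<phi> X else 0) = of_real (\<Sum>j\<in>U. if j \<in> X then ?g else 0) * \<phi> X"
    unfolding of_real_sum sum_distrib_right by (rule sum.cong) auto
  finally have pot: "(\<Sum>j=1..L. \<Sum>k=1..L. ?T j k) =
      of_real (\<Sum>j\<in>U. if j \<in> X then ?g else 0) * \<phi> X + hops Gp Gm ?l \<phi> X" .
  have "pair_energy (\<lambda>j. 2 * ?e j - ?g) ?l X = (\<Sum>j\<in>U. if j \<in> X then 2 * ?e j - ?g else 0)"
    unfolding pair_energy_def using fin by (subst sum_list_distinct_conv_sum_set) auto
  also have "\<dots> = (\<Sum>j\<in>U. if j \<in> X then 2 * ?e j else 0) - (\<Sum>j\<in>U. if j \<in> X then ?g else 0)"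
    unfolding sum_subtractf[symmetric] by (rule sum.cong) auto
  finally have en: "pair_energy (\<lambda>j. 2 * ?e j - ?g) ?l X =
      (\<Sum>j\<in>U. if j \<in> X then 2 * ?e j else 0) - (\<Sum>j\<in>U. if j \<in> X then ?g else 0)" .
  show ?thesis
    unfolding hamiltonian_def kin pot pair_ham_def en by (simp add: algebra_simps del: of_real_sum)
qed

theorem mainTheorem2:
  fixes L :: nat and \<delta> Gp Gm :: real
  assumes "L \<ge> 1" and "\<delta> > 0" and "Gp > 0" and "Gm > 0"
    and "Gp - Gm = 2 * \<delta> \<or> Gp - Gm = - 2 * \<delta>"
  shows "\<forall>E \<in> eigenvalues_on (Fock L) (hamiltonian L \<delta> Gp Gm). E \<in> \<real>"
proof
  fix E
  assume "E \<in> eigenvalues_on (Fock L) (hamiltonian L \<delta> Gp Gm)"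
  then obtain \<psi> where \<psi>: "\<psi> \<in> Fock L" "\<psi> \<noteq> (\<lambda>S. 0)" "hamiltonian L \<delta> Gp Gm \<psi> = (\<lambda>S. E * \<psi> S)"
    by (auto simp: eigenvalues_on_def)
  \<comment> \<open>A nonzero amplitude selects a sector on which the eigenvector does not
    vanish.\<close>
  then obtain S where S: "\<psi> S \<noteq> 0" "S \<subseteq> modes L"
    by (auto simp: Fock_def fun_eq_iff)
  define U where "U = unblocked L S"
  define l where "l = sorted_list_of_set U"
  define \<phi> where "\<phi> = (\<lambda>X. \<psi> (with_pairs L S X))"
  define c where "c = (\<Sum>j\<in>{1..L} - U. level L \<delta> j)"
  have "finite U"
    by (simp add: U_def unblocked_def)
  then have set_l: "set l = U"
    by (simp add: l_def)
  \<comment> \<open>Here \<open>h\<close> may have either sign; the gap condition sees only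
    \<open>\<bar>h\<bar>\<close>, which equals the level spacing.\<close>
  define h where "h = (Gp - Gm) / 2"
  have h: "Gp - Gm = 2 * h" "h \<noteq> 0" "\<bar>h\<bar> = \<delta>"
    using assms(2,5) by (auto simp: h_def)
  \<comment> \<open>Subtracting the energy of the blocked levels leaves an eigenvalue of the pair
    Hamiltonian.\<close>
  have "E - of_real c \<in> \<real>"
  proof (rule pair_ham_eigenvalue_real_closed[OF h(1,2)])
    have "\<bar>h\<bar> \<le> level L \<delta> y - level L \<delta> x" if "x < y" for x y
    proof -
      have "1 * \<delta> \<le> (real y - real x) * \<delta>"
        using that assms(2) by (intro mult_right_mono) auto
      then show ?thesis
        by (simp add: h level_def algebra_simps)
    qed
    then show "sorted_wrt (\<lambda>x y. \<bar>h\<bar> \<le> level L \<delta> y - level L \<delta> x) l"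
      unfolding l_def by (rule sorted_wrt_mono_rel[OF _ strict_sorted_list_of_set])
    show "pair_ham (level L \<delta>) Gp Gm l \<phi> X = (E - of_real c) * \<phi> X" if "X \<subseteq> set l" for X
    proof -
      have "X \<subseteq> unblocked L S"
        using that set_l by (simp add: U_def)
      from hamiltonian_with_pairs[OF this, of \<delta> Gp Gm \<psi>] \<psi>(3)
      have "E * \<phi> X = of_real c * \<phi> X + pair_ham (level L \<delta>) Gp Gm l \<phi> X"
        unfolding \<phi>_def c_def l_def U_def by simp
      then show ?thesis
        by (simp add: algebra_simps)
    qed
    \<comment> \<open>The pairs of \<open>S\<close> reproduce \<open>S\<close> itself, where the
      amplitude is nonzero.\<close>
    show "{j \<in> U. (j, Plus) \<in> S} \<subseteq> set l" "\<phi> {j \<in> U. (j, Plus) \<in> S} \<noteq> 0"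
      using S by (auto simp: set_l \<phi>_def U_def with_pairs_self)
  qed
  then have "(E - of_real c) + of_real c \<in> \<real>"
    by (intro Reals_add) auto
  then show "E \<in> \<real>"
    by simp
qed

end
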